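(* Let $f:[0,1]\times\mathbb{R}\to\mathbb{R}$ satisfy: (C(c)) $f$ is continuous on $[0,1]\times\mathbb{R}$ and has a continuous partial derivative $f_x$ with respect to the second variable on $[0,1]\times\mathbb{R}$; (C(f)) there exist positive constants $A,B$ with $A<\pi^2$ such that $|f(t,x)|\leqslant A|x|+B$ for all $t\in[0,1]$, $x\in\mathbb{R}$; (C($f_x$)) $\inf_{(t,x)\in[0,1]\times\mathbb{R}} f_x(t,x)>-\pi^2$. Then the operator $T:\mathbb{X}\to L^2(0,1)$, $(Tx)(t)=\ddot{x}(t)-f(t,x(t))$ (a.e. $t\in[0,1]$), is a diffeomorphism, i.e. a $C^1$ bijection whose inverse is also $C^1$.
   Context: $\mathbb{X}=H^2(0,1)\cap H^1_0(0,1)$, where $H^1_0(0,1)$ consists of absolutely continuous $x$ on $[0,1]$ with $x(0)=x(1)=0$ and $\dot x\in L^2$, and $H^2(0,1)$ of those $x\in H^1(0,1)$ with $\dot x\in H^1(0,1)$. $\mathbb{X}$ is equipped with the norm $\|x\|_{\mathbb{X}}=\|\ddot{x}\|_{L^2}$. *)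

theory Defs
  imports "HOL-Analysis.Analysis"
begin

definition abs_cont_on :: "real \<Rightarrow> real \<Rightarrow> (real \<Rightarrow> real) \<Rightarrow> bool" where
  "abs_cont_on a b x \<longleftrightarrow>
     (\<forall>\<epsilon>>0. \<exists>\<delta>>0. \<forall>(n::nat) (s::nat \<Rightarrow> real) (e::nat \<Rightarrow> real).
        (\<forall>i<n. a \<le> s i \<and> s i \<le> e i \<and> e i \<le> b) \<and>
        (\<forall>i<n. \<forall>j<n. i \<noteq> j \<longrightarrow> e i \<le> s j \<or> e j \<le> s i) \<and>
        (\<Sum>i<n. e i - s i) < \<delta>
        \<longrightarrow> (\<Sum>i<n. \<bar>x (e i) - x (s i)\<bar>) < \<epsilon>)"

section \<open>L^2(0,1) (on representatives; elements equal a.e. are identified via the seminorm)\<close>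

definition L2 :: "(real \<Rightarrow> real) \<Rightarrow> bool" where
  "L2 g \<longleftrightarrow> g \<in> borel_measurable (lebesgue_on {0..1}) \<and>
            integrable (lebesgue_on {0..1}) (\<lambda>t. (g t)\<^sup>2)"

definition L2_norm01 :: "(real \<Rightarrow> real) \<Rightarrow> real" where
  "L2_norm01 g = sqrt (LINT t|lebesgue_on {0..1}. (g t)\<^sup>2)"

definition ae_deriv :: "(real \<Rightarrow> real) \<Rightarrow> (real \<Rightarrow> real) \<Rightarrow> bool" where
  "ae_deriv x v \<longleftrightarrow> (AE t in lebesgue_on {0..1}. (x has_real_derivative v t) (at t))"

section \<open>The space X = H^2(0,1) \<inter> H^1_0(0,1)\<close>

text \<open>u is a second derivative of x in the H^2 sense: x is absolutely continuous with a.e.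
  derivative v, v is absolutely continuous (so x' has an H^1 representative) with a.e.
  derivative u, and u is in L^2 (hence also v is in L^2).\<close>
definition is_ddot :: "(real \<Rightarrow> real) \<Rightarrow> (real \<Rightarrow> real) \<Rightarrow> bool" where
  "is_ddot x u \<longleftrightarrow> (\<exists>v. abs_cont_on 0 1 x \<and> ae_deriv x v \<and> L2 v \<and>
                          abs_cont_on 0 1 v \<and> ae_deriv v u \<and> L2 u)"

definition Xsp :: "(real \<Rightarrow> real) set" where
  "Xsp = {x. x 0 = 0 \<and> x 1 = 0 \<and> (\<exists>u. is_ddot x u)}"

definition ddot :: "(real \<Rightarrow> real) \<Rightarrow> real \<Rightarrow> real" where
  "ddot x = (SOME u. is_ddot x u)"

definition X_norm :: "(real \<Rightarrow> real) \<Rightarrow> real" where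
  "X_norm x = L2_norm01 (ddot x)"

definition fadd :: "(real \<Rightarrow> real) \<Rightarrow> (real \<Rightarrow> real) \<Rightarrow> real \<Rightarrow> real" where
  "fadd x y = (\<lambda>t. x t + y t)"
definition fsub :: "(real \<Rightarrow> real) \<Rightarrow> (real \<Rightarrow> real) \<Rightarrow> real \<Rightarrow> real" where
  "fsub x y = (\<lambda>t. x t - y t)"
definition fscale :: "real \<Rightarrow> (real \<Rightarrow> real) \<Rightarrow> real \<Rightarrow> real" where
  "fscale c x = (\<lambda>t. c * x t)"

text \<open>A space is given by a set S of representatives (closed under pointwise linear
  operations) and a seminorm N; representatives at N-distance 0 are identified.\<close>

definition bounded_lin :: "(real \<Rightarrow> real) set \<Rightarrow> ((real \<Rightarrow> real) \<Rightarrow> real) \<Rightarrow>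
    (real \<Rightarrow> real) set \<Rightarrow> ((real \<Rightarrow> real) \<Rightarrow> real) \<Rightarrow> ((real \<Rightarrow> real) \<Rightarrow> (real \<Rightarrow> real)) \<Rightarrow> bool" where
  "bounded_lin S1 N1 S2 N2 L \<longleftrightarrow>
     (\<forall>h\<in>S1. L h \<in> S2) \<and>
     (\<forall>h\<in>S1. \<forall>k\<in>S1. N2 (fsub (L (fadd h k)) (fadd (L h) (L k))) = 0) \<and>
     (\<forall>h\<in>S1. \<forall>c::real. N2 (fsub (L (fscale c h)) (fscale c (L h))) = 0) \<and>
     (\<exists>K. \<forall>h\<in>S1. N2 (L h) \<le> K * N1 h)"

definition frechet_at :: "(real \<Rightarrow> real) set \<Rightarrow> ((real \<Rightarrow> real) \<Rightarrow> real) \<Rightarrow>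
    (real \<Rightarrow> real) set \<Rightarrow> ((real \<Rightarrow> real) \<Rightarrow> real) \<Rightarrow> ((real \<Rightarrow> real) \<Rightarrow> (real \<Rightarrow> real)) \<Rightarrow> (real \<Rightarrow> real) \<Rightarrow> ((real \<Rightarrow> real) \<Rightarrow> (real \<Rightarrow> real)) \<Rightarrow> bool" where
  "frechet_at S1 N1 S2 N2 F x L \<longleftrightarrow>
     bounded_lin S1 N1 S2 N2 L \<and>
     (\<forall>\<epsilon>>0. \<exists>\<delta>>0. \<forall>h\<in>S1. N1 h < \<delta> \<longrightarrow>
        N2 (fsub (fsub (F (fadd x h)) (F x)) (L h)) \<le> \<epsilon> * N1 h)"

definition C1_map :: "(real \<Rightarrow> real) set \<Rightarrow> ((real \<Rightarrow> real) \<Rightarrow> real) \<Rightarrow>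
    (real \<Rightarrow> real) set \<Rightarrow> ((real \<Rightarrow> real) \<Rightarrow> real) \<Rightarrow> ((real \<Rightarrow> real) \<Rightarrow> (real \<Rightarrow> real)) \<Rightarrow> bool" where
  "C1_map S1 N1 S2 N2 F \<longleftrightarrow>
     (\<forall>x\<in>S1. F x \<in> S2) \<and>
     (\<exists>DF. (\<forall>x\<in>S1. frechet_at S1 N1 S2 N2 F x (DF x)) \<and>
       (\<forall>x\<in>S1. \<forall>\<epsilon>>0. \<exists>\<delta>>0. \<forall>y\<in>S1. N1 (fsub y x) < \<delta> \<longrightarrow>
          (\<forall>h\<in>S1. N2 (fsub (DF y h) (DF x h)) \<le> \<epsilon> * N1 h)))"

definition diffeo :: "(real \<Rightarrow> real) set \<Rightarrow> ((real \<Rightarrow> real) \<Rightarrow> real) \<Rightarrow>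
    (real \<Rightarrow> real) set \<Rightarrow> ((real \<Rightarrow> real) \<Rightarrow> real) \<Rightarrow> ((real \<Rightarrow> real) \<Rightarrow> (real \<Rightarrow> real)) \<Rightarrow> bool" where
  "diffeo S1 N1 S2 N2 F \<longleftrightarrow>
     C1_map S1 N1 S2 N2 F \<and>
     (\<forall>x\<in>S1. \<forall>y\<in>S1. N2 (fsub (F x) (F y)) = 0 \<longrightarrow> N1 (fsub x y) = 0) \<and>
     (\<forall>g\<in>S2. \<exists>x\<in>S1. N2 (fsub (F x) g) = 0) \<and>
     (\<exists>G. C1_map S2 N2 S1 N1 G \<and>
          (\<forall>g\<in>S2. N2 (fsub (F (G g)) g) = 0) \<and>
          (\<forall>x\<in>S1. N1 (fsub (G (F x)) x) = 0))"

definition T_op :: "(real \<Rightarrow> real \<Rightarrow> real) \<Rightarrow> (real \<Rightarrow> real) \<Rightarrow> real \<Rightarrow> real" where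
  "T_op f x = (\<lambda>t. ddot x t - f t (x t))"

end

theory Submission
  imports Defs
begin

text \<open>Since \<open>f\<^sub>x \<ge> m > -\<pi>\<^sup>2\<close> and \<open>\<integral> w'\<^sup>2 \<ge> \<pi>\<^sup>2 \<integral> w\<^sup>2\<close> on \<open>X\<close>, the operator \<open>-T\<close> is strongly
  monotone: testing \<open>w'' - r\<close> with \<open>w\<close>, where \<open>r w \<ge> m w\<^sup>2\<close>, bounds \<open>sup \<bar>w\<bar>\<close> by a multiple of
  \<open>\<parallel>w'' - r\<parallel>\<close>. This one estimate gives injectivity, a local Lipschitz bound for the inverse, the
  invertibility bound for the linearisation \<open>h \<mapsto> h'' - f\<^sub>x(t, x) h\<close>, and surjectivity of both
  operators: truncating \<open>f\<close> at an a priori bound makes it globally Lipschitz, and then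
  \<open>x'' = \<lambda> f(t, x) + g\<close> is solved by continuation from \<open>\<lambda> = 0\<close> to \<open>\<lambda> = 1\<close> in steps short enough
  for the contraction principle in the sup norm. That the inverse is \<open>C\<^sup>1\<close> is then a formal
  consequence of these bounds.\<close>

section \<open>Absolutely continuous functions\<close>

text \<open>The derivatives in \<open>is_ddot\<close> are two-sided but hold only almost everywhere,
  so the fundamental theorem of calculus is needed in both directions for
  \<open>abs_cont_on\<close>: it turns the first derivative into a genuine one, justifies the
  integration by parts behind monotonicity, and produces solutions of \<open>x'' = g\<close>. A
  superposition operator is in general not differentiable from L2 to L2; here T is differentiable
  because X embeds into the sup norm, where the values of f_x along a graph vary uniformly
  continuously. A single contraction for \<open>x'' = f(t, x) + g\<close> would need a small
  Lipschitz constant. Continuation avoids this, since the constant of the monotonicity estimate sees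
  only the lower bound of the slope, never the Lipschitz constant M; hence all steps have one common
  length. For the same reason the a priori bound is known before M is: it involves only f(t, 0) + g.
  Finally, elements are representatives and \<open>ddot\<close> is a choice, so linearity and the
  inverse laws hold only up to seminorm 0, and the abstract inverse function theorem has to carry
  such null terms along.\<close>

lemma abs_cont_on_finite:
  assumes ac: "abs_cont_on a b f" and "\<epsilon> > 0"
  obtains \<delta> where "\<delta> > 0"
    "\<And>I s e. \<lbrakk>finite (I::'i set); \<And>i. i \<in> I \<Longrightarrow> a \<le> s i \<and> s i \<le> e i \<and> e i \<le> b;
        \<And>i j. \<lbrakk>i \<in> I; j \<in> I; i \<noteq> j\<rbrakk> \<Longrightarrow> e i \<le> s j \<or> e j \<le> s i; (\<Sum>i\<in>I. e i - s i) < \<delta>\<rbrakk>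
      \<Longrightarrow> (\<Sum>i\<in>I. \<bar>f (e i) - f (s i)\<bar>) < \<epsilon>"
proof -
  obtain \<delta> where "\<delta> > 0" and \<delta>: "\<And>(n::nat) (s::nat \<Rightarrow> real) e.
        (\<forall>i<n. a \<le> s i \<and> s i \<le> e i \<and> e i \<le> b) \<and>
        (\<forall>i<n. \<forall>j<n. i \<noteq> j \<longrightarrow> e i \<le> s j \<or> e j \<le> s i) \<and>
        (\<Sum>i<n. e i - s i) < \<delta>
        \<Longrightarrow> (\<Sum>i<n. \<bar>f (e i) - f (s i)\<bar>) < \<epsilon>"
    using ac[unfolded abs_cont_on_def] \<open>\<epsilon> > 0\<close> by blast
  show thesis
  proof (rule that[OF \<open>\<delta> > 0\<close>])
    fix I :: "'i set" and s e :: "'i \<Rightarrow> real"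
    assume I: "finite I" and bnd: "\<And>i. i \<in> I \<Longrightarrow> a \<le> s i \<and> s i \<le> e i \<and> e i \<le> b"
      and disj: "\<And>i j. \<lbrakk>i \<in> I; j \<in> I; i \<noteq> j\<rbrakk> \<Longrightarrow> e i \<le> s j \<or> e j \<le> s i"
      and small: "(\<Sum>i\<in>I. e i - s i) < \<delta>"
    \<comment> \<open>The definition numbers its intervals by an initial segment of the naturals;
      gauge sums index them by tagged pairs, so the family is renumbered.\<close>
    obtain h where h: "bij_betw h {..<card I} I"
      using ex_bij_betw_nat_finite[OF I] by (auto simp: atLeast0LessThan)
    have re: "(\<Sum>i\<in>I. g i) = (\<Sum>k<card I. g (h k))" for g :: "'i \<Rightarrow> real"
      by (rule sum.reindex_bij_betw[OF h, symmetric])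
    have hI: "h k \<in> I" if "k < card I" for k
      using h that by (auto simp: bij_betw_def)
    have inj: "h j \<noteq> h k" if "j < card I" "k < card I" "j \<noteq> k" for j k
      using h that by (auto simp: bij_betw_def inj_on_def)
    show "(\<Sum>i\<in>I. \<bar>f (e i) - f (s i)\<bar>) < \<epsilon>"
      unfolding re by (rule \<delta>) (use bnd disj small hI inj in \<open>auto simp: re\<close>)
  qed
qed

lemma abs_cont_on_subinterval:
  assumes "abs_cont_on a b f" "a \<le> c" "d \<le> b"
  shows "abs_cont_on c d f"
  unfolding abs_cont_on_def
proof (intro allI impI)
  fix \<epsilon> :: real assume "\<epsilon> > 0"
  then obtain \<delta> where "\<delta> > 0" and \<delta>: "\<And>(n::nat) (s::nat \<Rightarrow> real) e.
        (\<forall>i<n. a \<le> s i \<and> s i \<le> e i \<and> e i \<le> b) \<and>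
        (\<forall>i<n. \<forall>j<n. i \<noteq> j \<longrightarrow> e i \<le> s j \<or> e j \<le> s i) \<and>
        (\<Sum>i<n. e i - s i) < \<delta>
        \<Longrightarrow> (\<Sum>i<n. \<bar>f (e i) - f (s i)\<bar>) < \<epsilon>"
    using assms(1)[unfolded abs_cont_on_def] by blast
  show "\<exists>\<delta>>0. \<forall>(n::nat) s e.
            (\<forall>i<n. c \<le> s i \<and> s i \<le> e i \<and> e i \<le> d) \<and>
            (\<forall>i<n. \<forall>j<n. i \<noteq> j \<longrightarrow> e i \<le> s j \<or> e j \<le> s i) \<and> (\<Sum>i<n. e i - s i) < \<delta> \<longrightarrow>
            (\<Sum>i<n. \<bar>f (e i) - f (s i)\<bar>) < \<epsilon>"
    using \<open>\<delta> > 0\<close> assms(2,3) by (intro exI[of _ \<delta>] conjI allI impI \<delta>; fastforce)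
qed

text \<open>Gauge integral proof: tags outside \<open>N\<close> are handled by differentiability; the intervals tagged
  in \<open>N\<close> lie in an open set of small measure, where absolute continuity bounds the total
  variation of \<open>f\<close>.\<close>

theorem abs_cont_on_fundamental_theorem:
  fixes f v :: "real \<Rightarrow> real"
  assumes ac: "abs_cont_on a b f" and "a \<le> b" and N: "negligible N"
    and der: "\<And>t. t \<in> {a..b} - N \<Longrightarrow> (f has_real_derivative v t) (at t within {a..b})"
  shows "(v has_integral (f b - f a)) {a..b}"
proof (cases "a = b")
  case True
  then show ?thesis by (simp add: has_integral_refl)
next
  case False
  with \<open>a \<le> b\<close> have "a < b" by simp
  \<comment> \<open>Nothing is known about \<open>v\<close> on \<open>N\<close>. With the value 0
    there, a tag in \<open>N\<close> contributes only an increment of \<open>f\<close>; a spike on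
    the negligible set restores \<open>v\<close> at the end.\<close>
  define w where "w t = (if t \<in> N then 0 else v t)" for t
  have "(w has_integral (f b - f a)) (cbox a b)"
    unfolding has_integral_factor_content
  proof (intro allI impI)
    fix e :: real assume "e > 0"
    have e2: "e / 2 * (b - a) > 0" using \<open>e > 0\<close> \<open>a < b\<close> by simp
    obtain \<delta> where "\<delta> > 0" and \<delta>: "\<And>I s e'. \<lbrakk>finite (I::(real \<times> real set) set);
          \<And>i. i \<in> I \<Longrightarrow> a \<le> s i \<and> s i \<le> e' i \<and> e' i \<le> b;
          \<And>i j. \<lbrakk>i \<in> I; j \<in> I; i \<noteq> j\<rbrakk> \<Longrightarrow> e' i \<le> s j \<or> e' j \<le> s i; (\<Sum>i\<in>I. e' i - s i) < \<delta>\<rbrakk>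
        \<Longrightarrow> (\<Sum>i\<in>I. \<bar>f (e' i) - f (s i)\<bar>) < e / 2 * (b - a)"
      by (rule abs_cont_on_finite[OF ac e2, where ?'i = "real \<times> real set"]) blast
    have Nm: "N \<in> sets lebesgue" "emeasure lebesgue N = 0"
      using N by (auto simp: negligible_iff_null_sets null_sets_def)
    obtain T where T: "open T" "N \<subseteq> T" "T - N \<in> lmeasurable" "emeasure lebesgue (T - N) < ennreal \<delta>"
      using sets_lebesgue_outer_open[OF Nm(1) \<open>\<delta> > 0\<close>] by blast
    have T': "T \<in> lmeasurable" "measure lebesgue T < \<delta>"
    proof -
      have eq: "(T - N) \<union> N = T" using T by auto
      have "N \<in> lmeasurable" using Nm by (simp add: fmeasurable_def)
      from fmeasurable.Un[OF T(3) this] show Tm: "T \<in> lmeasurable" unfolding eq .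
      have "emeasure lebesgue ((T - N) \<union> N) = emeasure lebesgue (T - N)"
        using Nm T(3) by (intro emeasure_Un_null_set) (auto simp: null_sets_def fmeasurable_def)
      then have "emeasure lebesgue T = emeasure lebesgue (T - N)" unfolding eq .
      with T(4) show "measure lebesgue T < \<delta>"
        using Tm by (metis \<open>emeasure lebesgue T = emeasure lebesgue (T - N)\<close> emeasure_eq_measure2 ennreal_less_iff measure_nonneg)
    qed
    have "\<forall>x. \<exists>d>0. (x \<in> N \<longrightarrow> ball x d \<subseteq> T) \<and> (x \<in> {a..b} - N \<longrightarrow>
         (\<forall>y\<in>{a..b}. norm (y-x) < d \<longrightarrow> norm (f y - f x - (y-x) * v x) \<le> e/2 * norm (y-x)))"
    proof
      fix x
      consider "x \<in> N" | "x \<in> {a..b} - N" | "x \<notin> N" "x \<notin> {a..b}" by auto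
      then show "\<exists>d>0. (x \<in> N \<longrightarrow> ball x d \<subseteq> T) \<and> (x \<in> {a..b} - N \<longrightarrow>
         (\<forall>y\<in>{a..b}. norm (y-x) < d \<longrightarrow> norm (f y - f x - (y-x) * v x) \<le> e/2 * norm (y-x)))"
      proof cases
        case 1 then show ?thesis using T(1,2) by (auto simp: open_contains_ball)
      next
        case 2
        then have "(f has_vector_derivative v x) (at x within {a..b})"
          using der by (simp add: has_real_derivative_iff_has_vector_derivative)
        then show ?thesis using 2 \<open>e > 0\<close>
          unfolding has_vector_derivative_def has_derivative_within_alt
          by (auto dest!: spec[of _ "e/2"])
      next
        case 3 then show ?thesis by (auto intro: exI[of _ 1])
      qed
    qed
    then obtain d where d0: "\<And>x. d x > 0" and dN: "\<And>x. x \<in> N \<Longrightarrow> ball x (d x) \<subseteq> T"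
      and dv: "\<And>x y. \<lbrakk>x \<in> {a..b}; x \<notin> N; y \<in> {a..b}; norm (y-x) < d x\<rbrakk>
         \<Longrightarrow> norm (f y - f x - (y-x) * v x) \<le> e/2 * norm (y-x)"
      by (metis DiffI)
    show "\<exists>\<gamma>. gauge \<gamma> \<and> (\<forall>p. p tagged_division_of cbox a b \<and> \<gamma> fine p \<longrightarrow>
        norm ((\<Sum>(x, K)\<in>p. measure lborel K *\<^sub>R w x) - (f b - f a)) \<le> e * measure lborel (cbox a b))"
    proof (rule exI[of _ "\<lambda>x. ball x (d x)"], intro conjI allI impI; (elim conjE)?)
      show "gauge (\<lambda>x. ball x (d x))" using d0 gauge_ball_dependent by blast
    next
      fix p assume p: "p tagged_division_of cbox a b" and fine: "(\<lambda>x. ball x (d x)) fine p"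
      have fin: "finite p" using p by auto
      have box: "\<exists>u v. K = {u..v} \<and> u \<le> v \<and> x \<in> {u..v} \<and> {u..v} \<subseteq> {a..b} \<and> {u..v} \<subseteq> ball x (d x)"
        if xK: "(x, K) \<in> p" for x K
      proof -
        have "x \<in> K" "K \<subseteq> cbox a b" "K \<subseteq> ball x (d x)" using p that fine by (auto dest: fineD)
        moreover obtain u v where "K = cbox u v" using tagged_division_ofD(4)[OF p xK] by blast
        ultimately show ?thesis by (intro exI[of _ u] exI[of _ v]) (auto simp: subset_iff)
      qed
      have ba: "b - a = (\<Sum>(x,K)\<in>p. Sup K - Inf K)" "f b - f a = (\<Sum>(x,K)\<in>p. f(Sup K) - f(Inf K))"
        using additive_tagged_division_1[where f= "\<lambda>x. x"] additive_tagged_division_1[where f= f]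
              \<open>a \<le> b\<close> p by auto
      \<comment> \<open>One-point intervals are left out: such an interval may lie inside another
        one without violating disjointness of interiors, so it cannot be ordered against it, and its
        increment is 0 anyway.\<close>
      define p1 where "p1 = {(x,K) \<in> p. x \<in> N \<and> Inf K < Sup K}"
      define V :: "real \<times> real set \<Rightarrow> real" where "V = (\<lambda>(x, K). \<bar>f (Sup K) - f (Inf K)\<bar>)"
      have p1p: "p1 \<subseteq> p" by (auto simp: p1_def)
      have finp1: "finite p1" by (rule finite_subset[OF p1p fin])
      have tp1: "p1 tagged_partial_division_of cbox a b"
        by (rule tagged_partial_division_subset[OF _ p1p]) (use p in \<open>simp add: tagged_division_of_def\<close>)
      \<comment> \<open>The interiors are disjoint, so the total length is the measure of the union,
        and the gauge keeps that union inside \<open>T\<close>.\<close>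
      have len: "(\<Sum>i\<in>p1. Sup (snd i) - Inf (snd i)) < \<delta>"
      proof -
        have td: "p1 tagged_division_of \<Union>(snd ` p1)"
          by (rule tagged_partial_division_of_Union_self[OF tp1])
        have "(\<Sum>i\<in>p1. Sup (snd i) - Inf (snd i)) = (\<Sum>(x,K)\<in>p1. measure lborel K)"
        proof (rule sum.cong[OF refl])
          fix i assume "i \<in> p1"
          then obtain x K where i: "i = (x,K)" "(x,K) \<in> p" using p1p by (cases i) auto
          then show "Sup (snd i) - Inf (snd i) = (case i of (x,K) \<Rightarrow> measure lborel K)"
            using box[of x K] by auto
        qed
        also have "\<dots> = (\<Sum>K\<in>snd ` p1. measure lborel K)"
          by (rule sum.over_tagged_division_lemma[OF td]) (rule sum_content.box_empty_imp)
        also have "\<dots> = measure lebesgue (\<Union>(snd ` p1))"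
        proof (subst content_division[OF division_of_tagged_division[OF td], symmetric], rule sum.cong[OF refl])
          fix K assume "K \<in> snd ` p1"
          then obtain x where "(x, K) \<in> p" using p1p by auto
          then show "measure lborel K = measure lebesgue K" using box[of x K] by auto
        qed
        also have "\<dots> \<le> measure lebesgue T"
        proof (rule measure_mono_fmeasurable)
          show "\<Union>(snd ` p1) \<subseteq> T"
          proof clarify
            fix y x K assume "(x, K) \<in> p1" "y \<in> snd (x, K)"
            then have "x \<in> N" "y \<in> ball x (d x)" using box[of x K] by (auto simp: p1_def)
            then show "y \<in> T" using dN by blast
          qed
          show "\<Union>(snd ` p1) \<in> sets lebesgue"
            using finp1 box p1p by (intro sets.finite_Union) (fastforce)+
        qed (use T' in auto)
        finally show ?thesis using T' by simp
      qed
      have Vsmall: "(\<Sum>i\<in>p1. V i) < e/2 * (b - a)"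
      proof -
        have "(\<Sum>i\<in>p1. \<bar>f (Sup (snd i)) - f (Inf (snd i))\<bar>) < e/2 * (b - a)"
        proof (rule \<delta>[OF finp1 _ _ len])
          fix i assume "i \<in> p1"
          then obtain x K where "i = (x,K)" "(x,K) \<in> p" using p1p by (cases i) auto
          then show "a \<le> Inf (snd i) \<and> Inf (snd i) \<le> Sup (snd i) \<and> Sup (snd i) \<le> b"
            using box[of x K] by auto
        next
          fix i j assume ij: "i \<in> p1" "j \<in> p1" "i \<noteq> j"
          obtain x K y L where [simp]: "i = (x,K)" "j = (y,L)" by (cases i, cases j) auto
          have pp: "(x,K) \<in> p" "(y,L) \<in> p" "Inf K < Sup K" "Inf L < Sup L" using ij by (auto simp: p1_def)
          obtain u v where K: "K = {u..v}" "u \<le> v" using box pp(1) by blast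
          obtain s t where L: "L = {s..t}" "s \<le> t" using box pp(2) by blast
          have "interior K \<inter> interior L = {}"
            using p pp(1,2) ij(3) by (metis \<open>i = (x,K)\<close> \<open>j = (y,L)\<close> tagged_division_ofD(5))
          then have "{u<..<v} \<inter> {s<..<t} = {}" using K L by (simp add: interior_atLeastAtMost_real)
          moreover have "u < v" "s < t" using pp K L by auto
          ultimately have "v \<le> s \<or> t \<le> u"
          proof -
            have False if "s < v" "u < t"
            proof -
              have "max u s < min v t" using that \<open>u < v\<close> \<open>s < t\<close> by simp
              from dense[OF this] \<open>{u<..<v} \<inter> {s<..<t} = {}\<close> show False by auto
            qed
            then show ?thesis by force
          qed
          then show "Sup (snd i) \<le> Inf (snd j) \<or> Sup (snd j) \<le> Inf (snd i)" using K L by simp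
        qed
        then show ?thesis by (simp add: V_def case_prod_beta)
      qed
      have "norm (\<Sum>(x, K)\<in>p. measure lborel K *\<^sub>R w x - (f (Sup K) - f (Inf K)))
        \<le> (\<Sum>i\<in>p. (if i \<in> p1 then V i else 0) + e/2 * (case i of (x,K) \<Rightarrow> Sup K - Inf K))"
      proof (rule sum_norm_le)
        fix i assume "i \<in> p"
        obtain x K where i[simp]: "i = (x,K)" by (cases i)
        obtain u z where K: "K = {u..z}" "u \<le> z" "x \<in> {u..z}" "{u..z} \<subseteq> {a..b}" "{u..z} \<subseteq> ball x (d x)"
          using box \<open>i \<in> p\<close> by force
        have c: "measure lborel K = z - u" "Sup K = z" "Inf K = u" using K by auto
        show "norm (case i of (x,K) \<Rightarrow> measure lborel K *\<^sub>R w x - (f (Sup K) - f (Inf K)))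
          \<le> (if i \<in> p1 then V i else 0) + e/2 * (case i of (x,K) \<Rightarrow> Sup K - Inf K)"
        proof (cases "x \<in> N")
          case True
          show ?thesis
          proof (cases "u = z")
            case True then show ?thesis using c \<open>e > 0\<close> by (auto simp: p1_def V_def)
          next
            case False
            then have "i \<in> p1" using True \<open>i \<in> p\<close> c K by (auto simp: p1_def)
            then show ?thesis using True c K \<open>e > 0\<close> by (auto simp: V_def w_def abs_minus_commute)
          qed
        next
          case False
          have uz: "u \<in> {a..b}" "z \<in> {a..b}" "x \<in> {a..b}" "norm (u - x) < d x" "norm (z - x) < d x"
            using K(3,4) subsetD[OF K(5), of u] subsetD[OF K(5), of z] by (auto simp: dist_real_def)
          have "norm (f u - f x - (u - x) * v x) \<le> e/2 * norm (u - x)"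
               "norm (f z - f x - (z - x) * v x) \<le> e/2 * norm (z - x)"
            using dv uz False by auto
          moreover have "norm (u - x) = x - u" "norm (z - x) = z - x" using K by auto
          \<comment> \<open>The tag lies between the endpoints, so the errors at the two ends are
            measured by \<open>x - u\<close> and \<open>z - x\<close>, which add up to the length of
            the interval.\<close>
          moreover have "(z - u) * v x - (f z - f u) = (f u - f x - (u - x) * v x) - (f z - f x - (z - x) * v x)"
            by (simp add: algebra_simps)
          ultimately have "norm ((z - u) * v x - (f z - f u)) \<le> e/2 * (x - u) + e/2 * (z - x)"
            by (smt (verit) norm_triangle_ineq4)
          also have "\<dots> = e/2 * (z - u)" unfolding distrib_left[symmetric] by simp
          finally show ?thesis using False c by (simp add: w_def p1_def)
        qed
      qed
      also have "\<dots> = (\<Sum>i\<in>p1. V i) + e/2 * (b - a)"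
        unfolding sum.distrib ba(1) sum_distrib_left
        by (simp add: sum.inter_restrict[OF fin, symmetric] Int_absorb1[OF p1p])
      also have "\<dots> \<le> e * (b - a)" using Vsmall by (simp add: field_simps)
      finally show "norm ((\<Sum>(x, K)\<in>p. measure lborel K *\<^sub>R w x) - (f b - f a)) \<le> e * measure lborel (cbox a b)"
        unfolding ba(2) using \<open>a \<le> b\<close> by (simp add: sum_subtractf case_prod_beta)
    qed
  qed
  then show ?thesis
    unfolding box_real by (rule has_integral_spike[OF N, rotated -1]) (auto simp: w_def)
qed

lemma abs_cont_on_imp_continuous_on:
  assumes "abs_cont_on a b f"
  shows "continuous_on {a..b} f"
  unfolding continuous_on_iff
proof (intro ballI allI impI)
  fix x \<epsilon> :: real assume x: "x \<in> {a..b}" and "\<epsilon> > 0"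
  obtain \<delta> where "\<delta> > 0" and \<delta>: "\<And>I s e. \<lbrakk>finite (I::nat set);
        \<And>i. i \<in> I \<Longrightarrow> a \<le> s i \<and> s i \<le> e i \<and> e i \<le> b;
        \<And>i j. \<lbrakk>i \<in> I; j \<in> I; i \<noteq> j\<rbrakk> \<Longrightarrow> e i \<le> s j \<or> e j \<le> s i; (\<Sum>i\<in>I. e i - s i) < \<delta>\<rbrakk>
      \<Longrightarrow> (\<Sum>i\<in>I. \<bar>f (e i) - f (s i)\<bar>) < \<epsilon>"
    by (rule abs_cont_on_finite[OF assms \<open>\<epsilon> > 0\<close>, where ?'i = nat]) blast
  have "dist (f y) (f x) < \<epsilon>" if y: "y \<in> {a..b}" "dist y x < \<delta>" for y
    using \<delta>[of "{0}" "\<lambda>_. min x y" "\<lambda>_. max x y"] x y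
    by (cases "x \<le> y") (auto simp: dist_real_def abs_minus_commute)
  then show "\<exists>d>0. \<forall>y\<in>{a..b}. dist y x < d \<longrightarrow> dist (f y) (f x) < \<epsilon>"
    using \<open>\<delta> > 0\<close> by blast
qed

text \<open>Linear combinations and products share this argument: one family of intervals, shorter
  than both moduli, makes both variation sums small at once.\<close>

lemma abs_cont_on_dominated:
  assumes f: "abs_cont_on a b f" and g: "abs_cont_on a b g" and "C > 0"
    and le: "\<And>s e. \<lbrakk>s \<in> {a..b}; e \<in> {a..b}\<rbrakk> \<Longrightarrow> \<bar>h e - h s\<bar> \<le> C * (\<bar>f e - f s\<bar> + \<bar>g e - g s\<bar>)"
  shows "abs_cont_on a b h"
  unfolding abs_cont_on_def
proof (intro allI impI)
  fix \<epsilon> :: real assume "\<epsilon> > 0"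
  then have "\<epsilon> / (2 * C) > 0" using \<open>C > 0\<close> by simp
  obtain \<delta>1 where "\<delta>1 > 0" and \<delta>1: "\<And>(n::nat) (s::nat \<Rightarrow> real) e.
        (\<forall>i<n. a \<le> s i \<and> s i \<le> e i \<and> e i \<le> b) \<and>
        (\<forall>i<n. \<forall>j<n. i \<noteq> j \<longrightarrow> e i \<le> s j \<or> e j \<le> s i) \<and>
        (\<Sum>i<n. e i - s i) < \<delta>1
        \<Longrightarrow> (\<Sum>i<n. \<bar>f (e i) - f (s i)\<bar>) < \<epsilon> / (2 * C)"
    using f[unfolded abs_cont_on_def] \<open>\<epsilon> / (2 * C) > 0\<close> by blast
  obtain \<delta>2 where "\<delta>2 > 0" and \<delta>2: "\<And>(n::nat) (s::nat \<Rightarrow> real) e.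
        (\<forall>i<n. a \<le> s i \<and> s i \<le> e i \<and> e i \<le> b) \<and>
        (\<forall>i<n. \<forall>j<n. i \<noteq> j \<longrightarrow> e i \<le> s j \<or> e j \<le> s i) \<and>
        (\<Sum>i<n. e i - s i) < \<delta>2
        \<Longrightarrow> (\<Sum>i<n. \<bar>g (e i) - g (s i)\<bar>) < \<epsilon> / (2 * C)"
    using g[unfolded abs_cont_on_def] \<open>\<epsilon> / (2 * C) > 0\<close> by blast
  show "\<exists>\<delta>>0. \<forall>(n::nat) s e.
            (\<forall>i<n. a \<le> s i \<and> s i \<le> e i \<and> e i \<le> b) \<and>
            (\<forall>i<n. \<forall>j<n. i \<noteq> j \<longrightarrow> e i \<le> s j \<or> e j \<le> s i) \<and> (\<Sum>i<n. e i - s i) < \<delta> \<longrightarrow>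
            (\<Sum>i<n. \<bar>h (e i) - h (s i)\<bar>) < \<epsilon>"
  proof (intro exI[of _ "min \<delta>1 \<delta>2"] conjI allI impI)
    fix n :: nat and s e
    assume H: "(\<forall>i<n. a \<le> s i \<and> s i \<le> e i \<and> e i \<le> b) \<and>
            (\<forall>i<n. \<forall>j<n. i \<noteq> j \<longrightarrow> e i \<le> s j \<or> e j \<le> s i) \<and> (\<Sum>i<n. e i - s i) < min \<delta>1 \<delta>2"
    have "(\<Sum>i<n. \<bar>h (e i) - h (s i)\<bar>) \<le> (\<Sum>i<n. C * (\<bar>f (e i) - f (s i)\<bar> + \<bar>g (e i) - g (s i)\<bar>))"
      by (rule sum_mono, rule le) (use H in force)+
    also have "\<dots> = C * ((\<Sum>i<n. \<bar>f (e i) - f (s i)\<bar>) + (\<Sum>i<n. \<bar>g (e i) - g (s i)\<bar>))"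
      by (simp add: sum_distrib_left sum.distrib distrib_left)
    also have "\<dots> < C * (\<epsilon> / (2 * C) + \<epsilon> / (2 * C))"
      by (intro mult_strict_left_mono add_strict_mono \<delta>1 \<delta>2 \<open>C > 0\<close>) (use H in auto)
    also have "\<dots> = \<epsilon>" using \<open>C > 0\<close> by (simp add: field_simps)
    finally show "(\<Sum>i<n. \<bar>h (e i) - h (s i)\<bar>) < \<epsilon>" .
  qed (use \<open>\<delta>1 > 0\<close> \<open>\<delta>2 > 0\<close> in auto)
qed

lemma abs_cont_on_lincomb:
  assumes "abs_cont_on a b f" "abs_cont_on a b g"
  shows "abs_cont_on a b (\<lambda>t. c * f t + d * g t)"
proof (rule abs_cont_on_dominated[OF assms, of "\<bar>c\<bar> + \<bar>d\<bar> + 1"])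
  fix s e
  have "\<bar>(c * f e + d * g e) - (c * f s + d * g s)\<bar> = \<bar>c * (f e - f s) + d * (g e - g s)\<bar>"
    by (simp add: algebra_simps)
  also have "\<dots> \<le> \<bar>c\<bar> * \<bar>f e - f s\<bar> + \<bar>d\<bar> * \<bar>g e - g s\<bar>"
    by (metis abs_mult abs_triangle_ineq)
  also have "\<dots> \<le> (\<bar>c\<bar> + \<bar>d\<bar> + 1) * \<bar>f e - f s\<bar> + (\<bar>c\<bar> + \<bar>d\<bar> + 1) * \<bar>g e - g s\<bar>"
    by (intro add_mono mult_right_mono) auto
  finally show "\<bar>(c * f e + d * g e) - (c * f s + d * g s)\<bar> \<le> (\<bar>c\<bar> + \<bar>d\<bar> + 1) * (\<bar>f e - f s\<bar> + \<bar>g e - g s\<bar>)"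
    by (simp add: distrib_left)
qed auto

lemma abs_cont_on_mult:
  assumes f: "abs_cont_on a b f" and g: "abs_cont_on a b g"
  shows "abs_cont_on a b (\<lambda>t. f t * g t)"
proof -
  have "\<exists>B. \<forall>t\<in>{a..b}. \<bar>h t\<bar> \<le> B" if "abs_cont_on a b h" for h
    using compact_imp_bounded[OF compact_continuous_image[OF abs_cont_on_imp_continuous_on[OF that]]]
    by (auto simp: bounded_iff)
  then obtain B C where BC: "\<And>t. t \<in> {a..b} \<Longrightarrow> \<bar>f t\<bar> \<le> B" "\<And>t. t \<in> {a..b} \<Longrightarrow> \<bar>g t\<bar> \<le> C"
    using f g by metis
  show ?thesis
  proof (rule abs_cont_on_dominated[OF f g, of "\<bar>B\<bar> + \<bar>C\<bar> + 1"])
    fix s e assume se: "s \<in> {a..b}" "e \<in> {a..b}"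
    have "\<bar>f e * g e - f s * g s\<bar> = \<bar>g e * (f e - f s) + f s * (g e - g s)\<bar>"
      by (simp add: algebra_simps)
    also have "\<dots> \<le> \<bar>g e\<bar> * \<bar>f e - f s\<bar> + \<bar>f s\<bar> * \<bar>g e - g s\<bar>"
      by (metis abs_mult abs_triangle_ineq)
    also have "\<dots> \<le> (\<bar>B\<bar> + \<bar>C\<bar> + 1) * \<bar>f e - f s\<bar> + (\<bar>B\<bar> + \<bar>C\<bar> + 1) * \<bar>g e - g s\<bar>"
      using BC(1)[OF se(1)] BC(2)[OF se(2)] by (intro add_mono mult_right_mono) auto
    finally show "\<bar>f e * g e - f s * g s\<bar> \<le> (\<bar>B\<bar> + \<bar>C\<bar> + 1) * (\<bar>f e - f s\<bar> + \<bar>g e - g s\<bar>)"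
      by (simp add: distrib_left)
  qed auto
qed

section \<open>Square integrable functions\<close>

abbreviation leb01 :: "real measure" where "leb01 \<equiv> lebesgue_on {0..1}"

text \<open>Negligible sets belong to the gauge integral, null sets to the restricted Lebesgue
  measure. This lemma and the next translate between the two.\<close>

lemma AE_leb01_I:
  assumes "negligible N" "\<And>t. t \<in> {0..1} - N \<Longrightarrow> P t"
  shows "AE t in leb01. P t"
proof -
  have "N \<inter> {0..1} \<in> null_sets lebesgue"
    using assms(1) by (metis negligible_Int negligible_iff_null_sets)
  then have "N \<inter> {0..1} \<in> null_sets leb01"
    by (simp add: null_sets_restrict_space)
  then show ?thesis
    by (rule AE_I') (use assms(2) in auto)
qed

lemma AE_leb01_E:
  assumes "AE t in leb01. P t"
  obtains N where "negligible N" "\<And>t. t \<in> {0..1} - N \<Longrightarrow> P t"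
proof -
  obtain N where "N \<in> null_sets leb01" "{t \<in> space leb01. \<not> P t} \<subseteq> N"
    using assms by (auto simp: eventually_ae_filter)
  then show thesis
    by (intro that[of N]) (auto simp: null_sets_restrict_space negligible_iff_null_sets)
qed

lemma L2_measurable: "L2 g \<Longrightarrow> g \<in> borel_measurable leb01"
  by (simp add: L2_def)

lemma L2_mult_integrable:
  assumes "L2 f" "L2 g"
  shows "integrable leb01 (\<lambda>t. f t * g t)"
proof (rule Bochner_Integration.integrable_bound)
  show "integrable leb01 (\<lambda>t. (f t)\<^sup>2 + (g t)\<^sup>2)" using assms by (simp add: L2_def)
  show "(\<lambda>t. f t * g t) \<in> borel_measurable leb01"
    using assms by (intro borel_measurable_times L2_measurable)
  show "AE t in leb01. norm (f t * g t) \<le> norm ((f t)\<^sup>2 + (g t)\<^sup>2)"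
  proof (rule AE_I2)
    fix t
    have "2 * (\<bar>f t\<bar> * \<bar>g t\<bar>) \<le> \<bar>f t\<bar>\<^sup>2 + \<bar>g t\<bar>\<^sup>2"
      using sum_squares_bound[of "\<bar>f t\<bar>" "\<bar>g t\<bar>"] by simp
    moreover have "\<bar>f t\<bar> * \<bar>g t\<bar> \<le> 2 * (\<bar>f t\<bar> * \<bar>g t\<bar>)" by simp
    ultimately have "\<bar>f t\<bar> * \<bar>g t\<bar> \<le> (f t)\<^sup>2 + (g t)\<^sup>2" unfolding power2_abs by linarith
    then show "norm (f t * g t) \<le> norm ((f t)\<^sup>2 + (g t)\<^sup>2)"
      by (simp add: abs_mult)
  qed
qed

lemma L2_lincomb:
  assumes "L2 f" "L2 g"
  shows "L2 (\<lambda>t. c * f t + d * g t)"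
proof -
  have "integrable leb01 (\<lambda>t. c\<^sup>2 * (f t)\<^sup>2 + 2 * c * d * (f t * g t) + d\<^sup>2 * (g t)\<^sup>2)"
    using assms L2_mult_integrable[OF assms] by (simp add: L2_def)
  also have "(\<lambda>t. c\<^sup>2 * (f t)\<^sup>2 + 2 * c * d * (f t * g t) + d\<^sup>2 * (g t)\<^sup>2) = (\<lambda>t. (c * f t + d * g t)\<^sup>2)"
    by (simp add: power2_sum power_mult_distrib algebra_simps)
  finally show ?thesis
    using L2_measurable[OF assms(1)] L2_measurable[OF assms(2)]
    by (auto simp: L2_def intro!: borel_measurable_add borel_measurable_times)
qed

lemma L2_add: "L2 f \<Longrightarrow> L2 g \<Longrightarrow> L2 (\<lambda>t. f t + g t)"
  using L2_lincomb[of f g 1 1] by simp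
lemma L2_diff: "L2 f \<Longrightarrow> L2 g \<Longrightarrow> L2 (\<lambda>t. f t - g t)"
  using L2_lincomb[of f g 1 "-1"] by simp
lemma L2_cmult: "L2 f \<Longrightarrow> L2 (\<lambda>t. c * f t)"
  using L2_lincomb[of f f c 0] by simp

lemma L2_bounded:
  assumes "f \<in> borel_measurable leb01" "\<And>t. t \<in> {0..1} \<Longrightarrow> \<bar>f t\<bar> \<le> K"
  shows "L2 f"
  unfolding L2_def
proof
  show "integrable leb01 (\<lambda>t. (f t)\<^sup>2)"
  proof (rule Bochner_Integration.integrable_bound)
    show "integrable leb01 (\<lambda>t. K\<^sup>2)"
      by (simp add: integrable_restrict_space integrable_real_indicator)
    show "AE t in leb01. norm ((f t)\<^sup>2) \<le> norm (K\<^sup>2)"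
      using assms(2) by (intro AE_I2) (force simp: abs_le_square_iff[symmetric])
  qed (use assms in simp)
qed (use assms in simp)

lemma continuous_measurable01: "continuous_on {0..1} f \<Longrightarrow> f \<in> borel_measurable leb01"
  by (simp add: continuous_imp_measurable_on_sets_lebesgue)

lemma continuous_bounded01:
  assumes "continuous_on {0..1} (f::real\<Rightarrow>real)"
  obtains K where "K > 0" "\<And>t. t \<in> {0..1} \<Longrightarrow> \<bar>f t\<bar> \<le> K"
  using compact_imp_bounded[OF compact_continuous_image[OF assms]]
  by (auto simp: bounded_pos)

lemma L2_continuous: "continuous_on {0..1} f \<Longrightarrow> L2 f"
  by (metis L2_bounded continuous_bounded01 continuous_measurable01)

lemma L2_integrable: "L2 g \<Longrightarrow> integrable leb01 g"
  using L2_mult_integrable[of g "\<lambda>_. 1"] L2_continuous[of "\<lambda>_. 1"] by simp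

lemma L2_abs: "L2 g \<Longrightarrow> L2 (\<lambda>t. \<bar>g t\<bar>)"
  by (auto simp: L2_def intro: borel_measurable_abs)

lemma L2_norm01_nonneg [simp]: "L2_norm01 g \<ge> 0"
  by (simp add: L2_norm01_def)

lemma L2_norm01_sq: "(L2_norm01 g)\<^sup>2 = (LINT t|leb01. (g t)\<^sup>2)"
  by (simp add: L2_norm01_def)

lemma L2_norm01_scale: "L2_norm01 (\<lambda>t. c * g t) = \<bar>c\<bar> * L2_norm01 g"
  by (simp add: L2_norm01_def power_mult_distrib real_sqrt_mult)

text \<open>The integral of \<open>(f - s g)\<^sup>2\<close> is a nonnegative quadratic in
  \<open>s\<close>; it is evaluated at its minimiser \<open>B / C\<close>.\<close>

lemma L2_Cauchy_Schwarz:
  assumes f: "L2 f" and g: "L2 g"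
  shows "\<bar>LINT t|leb01. f t * g t\<bar> \<le> L2_norm01 f * L2_norm01 g"
proof -
  define A B C where "A = (LINT t|leb01. (f t)\<^sup>2)" and "B = (LINT t|leb01. f t * g t)"
    and "C = (LINT t|leb01. (g t)\<^sup>2)"
  have q: "0 \<le> A - 2 * s * B + s\<^sup>2 * C" for s
  proof -
    have "0 \<le> (LINT t|leb01. (f t - s * g t)\<^sup>2)" by simp
    also have "\<dots> = (LINT t|leb01. (f t)\<^sup>2 - 2 * s * (f t * g t) + s\<^sup>2 * (g t)\<^sup>2)"
      by (simp add: power2_diff power_mult_distrib algebra_simps)
    also have "\<dots> = A - 2 * s * B + s\<^sup>2 * C"
      unfolding A_def B_def C_def using f g L2_mult_integrable[OF f g]
      by (subst Bochner_Integration.integral_add Bochner_Integration.integral_diff;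
          simp add: L2_def)+
    finally show ?thesis .
  qed
  have A0: "A \<ge> 0" and C0: "C \<ge> 0" by (simp_all add: A_def C_def)
  have "B\<^sup>2 \<le> A * C"
  proof (cases "C = 0")
    case True
    have "B = 0"
    proof (rule ccontr)
      assume "B \<noteq> 0"
      \<comment> \<open>For \<open>C = 0\<close> the quadratic is affine in \<open>s\<close>, and
        this choice gives it the value -1.\<close>
      then show False using q[of "(A + 1) / (2 * B)"] True by simp
    qed
    then show ?thesis using True by simp
  next
    case False
    then have "0 \<le> (A - 2 * (B / C) * B + (B / C)\<^sup>2 * C) * C" using q[of "B / C"] C0 by simp
    also have "\<dots> = A * C - B\<^sup>2" using False by (simp add: field_simps power2_eq_square)
    finally show ?thesis by simp
  qed
  then have "sqrt (B\<^sup>2) \<le> sqrt (A * C)" by (rule real_sqrt_le_mono)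
  then show ?thesis by (simp add: real_sqrt_mult L2_norm01_def A_def B_def C_def)
qed

lemma L2_norm01_triangle:
  assumes f: "L2 f" and g: "L2 g"
  shows "L2_norm01 (\<lambda>t. f t + g t) \<le> L2_norm01 f + L2_norm01 g"
proof (rule power2_le_imp_le)
  have "(L2_norm01 (\<lambda>t. f t + g t))\<^sup>2 = (LINT t|leb01. (f t)\<^sup>2 + (g t)\<^sup>2 + 2 * (f t * g t))"
    by (simp add: L2_norm01_sq power2_sum algebra_simps)
  also have "\<dots> = (L2_norm01 f)\<^sup>2 + (L2_norm01 g)\<^sup>2 + 2 * (LINT t|leb01. f t * g t)"
    using f g L2_mult_integrable[OF f g] by (simp add: L2_norm01_sq L2_def)
  also have "\<dots> \<le> (L2_norm01 f + L2_norm01 g)\<^sup>2"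
    using L2_Cauchy_Schwarz[OF f g] by (simp add: power2_sum)
  finally show "(L2_norm01 (\<lambda>t. f t + g t))\<^sup>2 \<le> (L2_norm01 f + L2_norm01 g)\<^sup>2" .
qed simp

lemma L2_norm01_mono:
  assumes "L2 g" "f \<in> borel_measurable leb01" "\<And>t. t \<in> {0..1} \<Longrightarrow> \<bar>f t\<bar> \<le> \<bar>g t\<bar>"
  shows "L2_norm01 f \<le> L2_norm01 g"
  unfolding L2_norm01_def
proof (intro real_sqrt_le_mono Bochner_Integration.integral_mono_AE AE_I2)
  show g2: "integrable leb01 (\<lambda>t. (g t)\<^sup>2)" using assms by (simp add: L2_def)
  show le: "(f t)\<^sup>2 \<le> (g t)\<^sup>2" if "t \<in> space leb01" for t
    using assms(3) that by (simp add: abs_le_square_iff)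
  show "integrable leb01 (\<lambda>t. (f t)\<^sup>2)"
    by (rule Bochner_Integration.integrable_bound[OF g2]) (use assms(2) le in \<open>auto intro!: AE_I2\<close>)
qed

lemma L2_norm01_const: "L2_norm01 (\<lambda>t. c) = \<bar>c\<bar>"
  by (simp add: L2_norm01_def measure_restrict_space)

lemma L2_norm01_le_bound:
  assumes "f \<in> borel_measurable leb01" "\<And>t. t \<in> {0..1} \<Longrightarrow> \<bar>f t\<bar> \<le> K" "0 \<le> K"
  shows "L2_norm01 f \<le> K"
  using L2_norm01_mono[of "\<lambda>_. K" f] assms L2_continuous[of "\<lambda>_. K"] by (simp add: L2_norm01_const)

lemma L2_norm01_eq_0_iff:
  assumes "L2 g"
  shows "L2_norm01 g = 0 \<longleftrightarrow> (AE t in leb01. g t = 0)"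
  using assms unfolding L2_norm01_def L2_def
  by (simp add: integral_nonneg_eq_0_iff_AE)

lemma L2_norm01_cong_AE:
  assumes "f \<in> borel_measurable leb01" "g \<in> borel_measurable leb01" "AE t in leb01. f t = g t"
  shows "L2_norm01 f = L2_norm01 g"
  unfolding L2_norm01_def using assms
  by (intro arg_cong[of _ _ sqrt] integral_cong_AE) auto

section \<open>Indefinite integrals of square integrable functions\<close>

lemma indicator_measurable01: "indicat_real {s<..<e::real} \<in> borel_measurable leb01"
  by (rule measurable_restrict_space1) (simp add: borel_measurable_indicator)

text \<open>An integral over a subinterval becomes an inner product on all of [0,1], to which
  Cauchy-Schwarz applies. Open intervals are used so that the indicators of adjacent intervals do
  not overlap at a common endpoint.\<close>

lemma L2_integral_sub:
  assumes "L2 g"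
  shows "integrable leb01 (\<lambda>t. indicat_real {s<..<e} t * g t)"
    and "0 \<le> s \<Longrightarrow> s \<le> e \<Longrightarrow> e \<le> 1 \<Longrightarrow>
      (g has_integral (LINT t|leb01. indicat_real {s<..<e} t * g t)) {s..e}"
proof -
  have ind: "L2 (indicat_real {s<..<e})"
    by (rule L2_bounded[OF indicator_measurable01, of _ _ 1]) (auto simp: indicator_def)
  show int: "integrable leb01 (\<lambda>t. indicat_real {s<..<e} t * g t)"
    by (rule L2_mult_integrable[OF ind assms])
  assume se: "0 \<le> s" "s \<le> e" "e \<le> 1"
  let ?I = "LINT t|leb01. indicat_real {s<..<e} t * g t"
  have eq: "(\<lambda>t. indicat_real {s<..<e} t * g t) = (\<lambda>t. if t \<in> {s<..<e} then g t else 0)"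
    by (auto simp: indicator_def)
  have "((\<lambda>t. indicat_real {s<..<e} t * g t) has_integral ?I) {0..1}"
    by (rule has_integral_integral_lebesgue_on[OF int]) simp
  then have "((\<lambda>t. if t \<in> {s<..<e} then g t else 0) has_integral ?I) {0..1}"
    by (simp only: eq)
  then have "(g has_integral ?I) {s<..<e}"
    by (subst (asm) has_integral_restrict) (use se in \<open>auto simp: subset_iff\<close>)
  then show "(g has_integral (LINT t|leb01. indicat_real {s<..<e} t * g t)) {s..e}"
    using has_integral_open_interval[of g _ s e] by simp
qed

lemma L2_integrable_sub:
  assumes "L2 g" "0 \<le> s" "e \<le> 1"
  shows "g integrable_on {s..e}"
proof (cases "s \<le> e")
  case True then show ?thesis using L2_integral_sub(2)[OF assms(1)] assms by blast
qed (simp add: integrable_on_empty)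

lemma L2_integral_split:
  assumes "L2 g" "0 \<le> s" "s \<le> e" "e \<le> 1"
  shows "integral {0..e} g - integral {0..s} g = integral {s..e} g"
  using Henstock_Kurzweil_Integration.integral_combine[of 0 s e g] L2_integrable_sub[of g 0 e] assms by simp

text \<open>For non-overlapping intervals the sum \<open>\<phi>\<close> of their indicators takes
  only the values 0 and 1, so its norm is the square root of the total length. Cauchy-Schwarz then
  bounds the variation sum by that root times the norm of \<open>g\<close>.\<close>

lemma abs_cont_on_integral:
  assumes g: "L2 g"
  shows "abs_cont_on 0 1 (\<lambda>t. c + integral {0..t} g)"
  unfolding abs_cont_on_def
proof (intro allI impI)
  fix \<epsilon> :: real assume "\<epsilon> > 0"
  \<comment> \<open>Chosen so that \<open>sqrt \<delta> * L2_norm01 g\<close> stays below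
    \<open>\<epsilon>\<close>; the added 1 covers the case of norm 0.\<close>
  define \<delta> where "\<delta> = (\<epsilon> / (L2_norm01 g + 1))\<^sup>2"
  have N1: "L2_norm01 g + 1 > 0" using L2_norm01_nonneg[of g] by linarith
  have "\<delta> > 0" using \<open>\<epsilon> > 0\<close> N1 by (simp add: \<delta>_def)
  show "\<exists>\<delta>>0. \<forall>(n::nat) s e.
            (\<forall>i<n. 0 \<le> s i \<and> s i \<le> e i \<and> e i \<le> 1) \<and>
            (\<forall>i<n. \<forall>j<n. i \<noteq> j \<longrightarrow> e i \<le> s j \<or> e j \<le> s i) \<and> (\<Sum>i<n. e i - s i) < \<delta> \<longrightarrow>
            (\<Sum>i<n. \<bar>c + integral {0..e i} g - (c + integral {0..s i} g)\<bar>) < \<epsilon>"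
  proof (intro exI[of _ \<delta>] conjI allI impI; (elim conjE)?)
    fix n :: nat and s e
    assume se: "\<forall>i<n. 0 \<le> s i \<and> s i \<le> e i \<and> e i \<le> 1"
      and disj: "\<forall>i<n. \<forall>j<n. i \<noteq> j \<longrightarrow> e i \<le> s j \<or> e j \<le> s i"
      and small: "(\<Sum>i<n. e i - s i) < \<delta>"
    define \<phi> where "\<phi> t = (\<Sum>i<n. indicat_real {s i<..<e i} t)" for t
    have \<phi>01: "(\<phi> t)\<^sup>2 = \<phi> t \<and> \<bar>\<phi> t\<bar> \<le> 1" for t
    proof (cases "\<exists>i<n. t \<in> {s i<..<e i}")
      case True
      then obtain i where i: "i < n" "t \<in> {s i<..<e i}" by blast
      have "indicat_real {s j<..<e j} t = (if j = i then 1 else 0)" if "j < n" for j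
        using disj that i by (cases "j = i") (force simp: indicator_def)+
      then have "\<phi> t = 1" unfolding \<phi>_def using i by simp
      then show ?thesis by simp
    next
      case False
      then have "\<phi> t = 0" unfolding \<phi>_def by (intro sum.neutral) (auto simp: indicator_def)
      then show ?thesis by simp
    qed
    have \<phi>m: "\<phi> \<in> borel_measurable leb01"
      unfolding \<phi>_def by (intro borel_measurable_sum indicator_measurable01)
    have \<phi>2: "L2 \<phi>" by (rule L2_bounded[OF \<phi>m, of 1]) (use \<phi>01 in auto)
    have one: "L2 (\<lambda>_. 1)" by (rule L2_continuous) simp
    have "(LINT t|leb01. \<phi> t) = (\<Sum>i<n. LINT t|leb01. indicat_real {s i<..<e i} t * 1)"
      unfolding \<phi>_def using L2_integral_sub(1)[OF one]
      by (subst Bochner_Integration.integral_sum) auto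
    also have "\<dots> = (\<Sum>i<n. e i - s i)"
    proof (rule sum.cong[OF refl])
      fix i assume "i \<in> {..<n}"
      then have "((\<lambda>_. 1::real) has_integral (LINT t|leb01. indicat_real {s i<..<e i} t * 1)) {s i..e i}"
        using L2_integral_sub(2)[OF one] se by auto
      moreover have "((\<lambda>_. 1::real) has_integral (e i - s i)) {s i..e i}"
        using has_integral_const_real[of "1::real" "s i" "e i"] se \<open>i \<in> _\<close> by auto
      ultimately show "(LINT t|leb01. indicat_real {s i<..<e i} t * 1) = e i - s i"
        by (rule has_integral_unique)
    qed
    finally have n\<phi>: "L2_norm01 \<phi> = sqrt (\<Sum>i<n. e i - s i)"
      unfolding L2_norm01_def using \<phi>01 by simp
    have ga: "L2 (\<lambda>t. \<bar>g t\<bar>)" by (rule L2_abs[OF g])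
    have "(\<Sum>i<n. \<bar>c + integral {0..e i} g - (c + integral {0..s i} g)\<bar>)
        \<le> (\<Sum>i<n. LINT t|leb01. indicat_real {s i<..<e i} t * \<bar>g t\<bar>)"
    proof (rule sum_mono)
      fix i assume "i \<in> {..<n}"
      then have i: "0 \<le> s i" "s i \<le> e i" "e i \<le> 1" using se by auto
      have "\<bar>c + integral {0..e i} g - (c + integral {0..s i} g)\<bar> = \<bar>integral {s i..e i} g\<bar>"
        using L2_integral_split[OF g i] by simp
      also have "\<dots> \<le> integral {s i..e i} (\<lambda>t. \<bar>g t\<bar>)"
        using integral_norm_bound_integral[OF L2_integrable_sub[OF g i(1,3)] L2_integrable_sub[OF ga i(1,3)]] by simp
      also have "\<dots> = (LINT t|leb01. indicat_real {s i<..<e i} t * \<bar>g t\<bar>)"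
        using L2_integral_sub(2)[OF ga i] by (rule integral_unique)
      finally show "\<bar>c + integral {0..e i} g - (c + integral {0..s i} g)\<bar>
        \<le> (LINT t|leb01. indicat_real {s i<..<e i} t * \<bar>g t\<bar>)" .
    qed
    also have "\<dots> = (LINT t|leb01. \<phi> t * \<bar>g t\<bar>)"
      unfolding \<phi>_def sum_distrib_right
      by (subst Bochner_Integration.integral_sum) (use L2_integral_sub(1)[OF ga] in auto)
    also have "\<dots> \<le> L2_norm01 \<phi> * L2_norm01 (\<lambda>t. \<bar>g t\<bar>)"
      using L2_Cauchy_Schwarz[OF \<phi>2 ga] by linarith
    also have "\<dots> = sqrt (\<Sum>i<n. e i - s i) * L2_norm01 g"
      unfolding n\<phi> by (simp add: L2_norm01_def)
    also have "\<dots> \<le> sqrt \<delta> * L2_norm01 g"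
      using small by (intro mult_right_mono real_sqrt_le_mono) auto
    also have "\<dots> = \<epsilon> / (L2_norm01 g + 1) * L2_norm01 g"
      using \<open>\<epsilon> > 0\<close> N1 by (simp add: \<delta>_def)
    also have "\<dots> < \<epsilon>" using \<open>\<epsilon> > 0\<close> N1 by (simp add: field_simps)
    finally show "(\<Sum>i<n. \<bar>c + integral {0..e i} g - (c + integral {0..s i} g)\<bar>) < \<epsilon>" .
  qed (use \<open>\<delta> > 0\<close> in auto)
qed

text \<open>The library's differentiation theorem is about averages to the right of a point; the left
  derivative comes from applying it to the reflected function.\<close>

lemma ae_deriv_integral:
  assumes g: "L2 g"
  shows "ae_deriv (\<lambda>t. c + integral {0..t} g) g"
proof -
  \<comment> \<open>Extension by 0: the differentiation theorem asks for integrability on every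
    interval, and the reflection leaves [0,1].\<close>
  define G where "G t = (if t \<in> {0..1} then g t else 0)" for t
  have "g integrable_on {0..1}" using L2_integrable_sub[OF g] by simp
  then have GU: "G integrable_on UNIV" unfolding G_def by (rule Henstock_Kurzweil_Integration.integrable_restrict_UNIV[THEN iffD2])
  then have Gi: "G integrable_on cbox a b" for a b using integrable_on_subcbox by blast
  then have Gi': "(\<lambda>t. G (- t)) integrable_on cbox a b" for a b
    using integrable_reflect[of G "-a" "-b"] by (metis add.inverse_inverse integrable_reflect)
  obtain N1 where N1: "negligible N1" "\<And>x e. \<lbrakk>x \<notin> N1; 0 < e\<rbrakk> \<Longrightarrow>
       \<exists>d>0. \<forall>h. 0 < h \<and> h < d \<longrightarrow> norm (integral (cbox x (x + h *\<^sub>R One)) G /\<^sub>R h ^ DIM(real) - G x) < e"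
    using integrable_ccontinuous_explicit[of G] Gi by blast
  obtain N2 where N2: "negligible N2" "\<And>x e. \<lbrakk>x \<notin> N2; 0 < e\<rbrakk> \<Longrightarrow>
       \<exists>d>0. \<forall>h. 0 < h \<and> h < d \<longrightarrow> norm (integral (cbox x (x + h *\<^sub>R One)) (\<lambda>t. G (- t)) /\<^sub>R h ^ DIM(real) - G (- x)) < e"
    using integrable_ccontinuous_explicit[of "\<lambda>t. G (- t)"] Gi' by blast
  have N2': "negligible (uminus ` N2)"
    by (rule negligible_differentiable_image_negligible[OF _ N2(1)]) (auto intro!: derivative_intros simp: differentiable_on_def)
  show ?thesis unfolding ae_deriv_def
  \<comment> \<open>The required derivative is two-sided, so the endpoints of [0,1] join the
    exceptional set.\<close>
  proof (rule AE_leb01_I[of "N1 \<union> uminus ` N2 \<union> {0,1}"])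
    show "negligible (N1 \<union> uminus ` N2 \<union> {0,1})" using N1 N2' by simp
    fix x assume "x \<in> {0..1} - (N1 \<union> uminus ` N2 \<union> {0,1})"
    then have x: "0 < x" "x < 1" "x \<notin> N1" "- x \<notin> N2" by force+
    let ?P = "\<lambda>t. c + integral {0..t} g"
    have Gg: "integral {s..e} G = integral {s..e} g" if "0 \<le> s" "e \<le> 1" for s e
      by (rule integral_cong) (use that in \<open>auto simp: G_def\<close>)
    have inc: "?P e - ?P s = integral {s..e} G" if "0 \<le> s" "s \<le> e" "e \<le> 1" for s e
      using L2_integral_split[OF g that] Gg that by simp
    have "(\<lambda>h. (?P (x + h) - ?P x) / h) \<midarrow>0\<rightarrow> g x"
      unfolding LIM_eq
    proof (intro allI impI)
      fix \<epsilon> :: real assume "\<epsilon> > 0"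
      obtain d1 where d1: "d1 > 0" "\<And>h. 0 < h \<and> h < d1 \<Longrightarrow> norm (integral {x..x+h} G / h - G x) < \<epsilon>"
        using N1(2)[OF x(3) \<open>\<epsilon> > 0\<close>] by (auto simp: divide_inverse mult.commute)
      obtain d2 where d2: "d2 > 0" "\<And>h. 0 < h \<and> h < d2 \<Longrightarrow>
          norm (integral {-x..-x+h} (\<lambda>t. G (- t)) / h - G x) < \<epsilon>"
        using N2(2)[OF x(4) \<open>\<epsilon> > 0\<close>] by (auto simp: divide_inverse mult.commute)
      have refl: "integral {-x..-x+h} (\<lambda>t. G (- t)) = integral {x-h..x} G" for h
        using Henstock_Kurzweil_Integration.integral_reflect_real[of x "x - h" G] by simp
      have Gx: "G x = g x" using x by (simp add: G_def)
      show "\<exists>s>0. \<forall>h. h \<noteq> 0 \<and> norm (h - 0) < s \<longrightarrow> norm ((?P (x + h) - ?P x) / h - g x) < \<epsilon>"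
      proof (intro exI[of _ "min (min d1 d2) (min x (1 - x))"] conjI allI impI)
        fix h :: real assume h: "h \<noteq> 0 \<and> norm (h - 0) < min (min d1 d2) (min x (1 - x))"
        show "norm ((?P (x + h) - ?P x) / h - g x) < \<epsilon>"
        proof (cases "h > 0")
          case True
          then have "?P (x + h) - ?P x = integral {x..x+h} G" using inc[of x "x+h"] h x by auto
          then show ?thesis using d1(2)[of h] h True Gx by simp
        next
          case False
          then have h0: "h < 0" "-h < d2" "-h < x" using h by auto
          then have "?P x - ?P (x + h) = integral {x+h..x} G" using inc[of "x+h" x] x by auto
          then have "(?P (x + h) - ?P x) / h = integral {x-(-h)..x} G / (-h)"
            using h0 by (simp add: field_simps)
          then show ?thesis using d2(2)[of "-h"] h0 Gx refl[of "-h"] by simp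
        qed
      qed (use d1 d2 x in auto)
    qed
    then show "(?P has_real_derivative g x) (at x)" by (simp add: DERIV_def)
  qed
qed

section \<open>The space X and the basic estimate\<close>

lemma real_integral_leb01:
  assumes "integrable leb01 f" "(f has_integral I) {0..1}"
  shows "(LINT t|leb01. f t) = (I::real)"
  using has_integral_unique[OF has_integral_integral_lebesgue_on[OF assms(1)] assms(2)] by simp

lemma abs_cont_ae_deriv_integral:
  assumes "abs_cont_on 0 1 f" "ae_deriv f v" "0 \<le> s" "s \<le> e" "e \<le> 1"
  shows "(v has_integral (f e - f s)) {s..e}"
proof -
  obtain N where N: "negligible N" "\<And>t. t \<in> {0..1} - N \<Longrightarrow> (f has_real_derivative v t) (at t)"
    using assms(2) unfolding ae_deriv_def by (rule AE_leb01_E) blast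
  show ?thesis
    by (rule abs_cont_on_fundamental_theorem[OF abs_cont_on_subinterval[OF assms(1,3,5)] assms(4) N(1)])
      (use N(2) assms in \<open>auto intro: has_field_derivative_at_within\<close>)
qed

text \<open>The a.e. derivative \<open>v\<close> of \<open>x\<close> is continuous and
  \<open>x\<close> is its indefinite integral, so it is the derivative at every point, one-sided at
  0 and 1. Everything later uses this form of the definition.\<close>

lemma is_ddotE:
  assumes "is_ddot x u"
  obtains v where "abs_cont_on 0 1 x" "abs_cont_on 0 1 v" "ae_deriv v u" "L2 u"
    "continuous_on {0..1} x" "continuous_on {0..1} v"
    "\<And>t. t \<in> {0..1} \<Longrightarrow> (x has_real_derivative v t) (at t within {0..1})"
proof -
  obtain v where v: "abs_cont_on 0 1 x" "ae_deriv x v" "L2 v" "abs_cont_on 0 1 v" "ae_deriv v u" "L2 u"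
    using assms unfolding is_ddot_def by blast
  have cv: "continuous_on {0..1} v" by (rule abs_cont_on_imp_continuous_on[OF v(4)])
  have "(x has_real_derivative v t) (at t within {0..1})" if t: "t \<in> {0..1}" for t
  proof -
    have "((\<lambda>t. integral {0..t} v) has_real_derivative v t) (at t within {0..1})"
      using integral_has_real_derivative[OF cv t] .
    then have "((\<lambda>t. x 0 + integral {0..t} v) has_real_derivative v t) (at t within {0..1})"
      by (auto intro!: derivative_eq_intros)
    then show ?thesis
    proof (rule has_field_derivative_transform_within[OF _ zero_less_one t])
      fix s :: real assume "s \<in> {0..1}"
      then show "x 0 + integral {0..s} v = x s"
        using abs_cont_ae_deriv_integral[OF v(1,2), of 0 s] by (auto dest: integral_unique)
    qed
  qed
  then show thesis using that v cv abs_cont_on_imp_continuous_on[OF v(1)] by blast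
qed

lemma ae_deriv_lincomb:
  assumes "ae_deriv f u" "ae_deriv g v"
  shows "ae_deriv (\<lambda>t. c * f t + d * g t) (\<lambda>t. c * u t + d * v t)"
  using assms unfolding ae_deriv_def
  by eventually_elim (auto intro!: derivative_eq_intros)

lemma is_ddot_lincomb:
  assumes "is_ddot x u" "is_ddot y w"
  shows "is_ddot (\<lambda>t. c * x t + d * y t) (\<lambda>t. c * u t + d * w t)"
proof -
  obtain v where "abs_cont_on 0 1 x" "ae_deriv x v" "L2 v" "abs_cont_on 0 1 v" "ae_deriv v u" "L2 u"
    using assms(1) unfolding is_ddot_def by blast
  moreover obtain z where "abs_cont_on 0 1 y" "ae_deriv y z" "L2 z" "abs_cont_on 0 1 z" "ae_deriv z w" "L2 w"
    using assms(2) unfolding is_ddot_def by blast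
  ultimately show ?thesis unfolding is_ddot_def
    by (intro exI[of _ "\<lambda>t. c * v t + d * z t"] conjI abs_cont_on_lincomb ae_deriv_lincomb L2_lincomb)
qed

lemma is_ddot_L2: "is_ddot x u \<Longrightarrow> L2 u"
  by (auto simp: is_ddot_def)

text \<open>Two witnesses for the first derivative are both genuine derivatives of \<open>x\<close>,
  hence equal on the open interval, and functions that agree near a point have the same derivative
  there. This is what makes the choice hidden in \<open>ddot\<close> harmless under the
  norm.\<close>

lemma is_ddot_unique:
  assumes "is_ddot x u" "is_ddot x w"
  shows "AE t in leb01. u t = w t"
proof -
  obtain v where v: "ae_deriv v u"
    "\<And>t. t \<in> {0..1} \<Longrightarrow> (x has_real_derivative v t) (at t within {0..1})"
    using assms(1) by (elim is_ddotE) blast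
  obtain z where z: "ae_deriv z w"
    "\<And>t. t \<in> {0..1} \<Longrightarrow> (x has_real_derivative z t) (at t within {0..1})"
    using assms(2) by (elim is_ddotE) blast
  have vz: "v t = z t" if "t \<in> {0<..<1}" for t
  proof -
    have "at t within {0..1} = at t" using that by (simp add: at_within_Icc_at)
    then show ?thesis using v(2)[of t] z(2)[of t] that by (auto intro: DERIV_unique)
  qed
  have "AE t in leb01. t \<in> {0<..<1}"
    by (rule AE_leb01_I[of "{0,1}"]) auto
  then show ?thesis using v(1) z(1) unfolding ae_deriv_def
  proof eventually_elim
    case (elim t)
    have "eventually (\<lambda>s. v s = z s) (nhds t)"
      using eventually_nhds_in_open[of "{0<..<1}" t] elim(1) by (auto elim: eventually_mono simp: vz)
    then have "(z has_real_derivative u t) (at t)"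
      using elim(2) by (simp cong: DERIV_cong_ev)
    then show ?case using elim(3) by (rule DERIV_unique)
  qed
qed

lemma is_ddot_ddot: "is_ddot x u \<Longrightarrow> is_ddot x (ddot x)"
  unfolding ddot_def by (rule someI[of "is_ddot x"])

lemma Xsp_is_ddot: "x \<in> Xsp \<Longrightarrow> is_ddot x (ddot x)"
  by (auto simp: Xsp_def intro: is_ddot_ddot)

lemma XspI: "is_ddot x u \<Longrightarrow> x 0 = 0 \<Longrightarrow> x 1 = 0 \<Longrightarrow> x \<in> Xsp"
  by (auto simp: Xsp_def)

lemma Xsp_D: "x \<in> Xsp \<Longrightarrow> x 0 = 0" "x \<in> Xsp \<Longrightarrow> x 1 = 0" "x \<in> Xsp \<Longrightarrow> continuous_on {0..1} x"
  by (auto simp: Xsp_def elim: is_ddotE)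

lemma X_norm_eq:
  assumes "is_ddot x u"
  shows "X_norm x = L2_norm01 u"
  unfolding X_norm_def
  using is_ddot_unique[OF is_ddot_ddot[OF assms] assms] is_ddot_L2[OF assms] is_ddot_L2[OF is_ddot_ddot[OF assms]]
  by (intro L2_norm01_cong_AE L2_measurable)

lemma Xsp_lincomb:
  assumes "x \<in> Xsp" "y \<in> Xsp"
  shows "(\<lambda>t. c * x t + d * y t) \<in> Xsp"
  by (rule XspI[OF is_ddot_lincomb[OF Xsp_is_ddot[OF assms(1)] Xsp_is_ddot[OF assms(2)]]])
    (use assms in \<open>auto simp: Xsp_D\<close>)

text \<open>Two integrations invert the second derivative under the boundary conditions. This is the
  starting point \<open>\<lambda> = 0\<close> of the continuation.\<close>

lemma Xsp_Green:
  assumes g: "L2 g"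
  obtains x where "x \<in> Xsp" "is_ddot x g"
proof -
  define v0 where "v0 t = integral {0..t} g" for t
  have ac0: "abs_cont_on 0 1 v0" unfolding v0_def using abs_cont_on_integral[OF g, of 0] by simp
  have c0: "L2 v0" by (rule L2_continuous[OF abs_cont_on_imp_continuous_on[OF ac0]])
  \<comment> \<open>The free constant of the first integration is spent on the condition at the
    right end, since \<open>x 1 = c + integral {0..1} v0\<close>.\<close>
  define c where "c = - integral {0..1} v0"
  define v where "v t = c + integral {0..t} g" for t
  have acv: "abs_cont_on 0 1 v" unfolding v_def by (rule abs_cont_on_integral[OF g])
  have L2v: "L2 v" by (rule L2_continuous[OF abs_cont_on_imp_continuous_on[OF acv]])
  define x where "x t = 0 + integral {0..t} v" for t
  have ddx: "is_ddot x g" unfolding is_ddot_def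
  proof (intro exI[of _ v] conjI)
    show "abs_cont_on 0 1 x" "ae_deriv x v"
      unfolding x_def by (rule abs_cont_on_integral[OF L2v], rule ae_deriv_integral[OF L2v])
    show "ae_deriv v g" unfolding v_def by (rule ae_deriv_integral[OF g])
  qed (use acv L2v g in auto)
  have "x 1 = integral {0..1} (\<lambda>t. c + v0 t)" by (simp add: x_def v_def[abs_def] v0_def)
  also have "\<dots> = c + integral {0..1} v0"
    using Henstock_Kurzweil_Integration.integral_add[OF integrable_const_ivl[of c 0 1] L2_integrable_sub[OF c0, of 0 1]] by simp
  also have "\<dots> = 0" by (simp add: c_def)
  finally have "x 1 = 0" .
  moreover have "x 0 = 0" by (simp add: x_def)
  ultimately show thesis using that[OF XspI[OF ddx] ddx] by blast
qed

text \<open>With \<open>c(t) = -k tan (k (t - 1/2))\<close> one has \<open>c' = -k\<^sup>2 - c\<^sup>2\<close>, so that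
  \<open>v\<^sup>2 - k\<^sup>2 w\<^sup>2 - (c w\<^sup>2)' = (v - c w)\<^sup>2\<close>; the assumption \<open>k < \<pi>\<close> keeps \<open>c\<close> finite on \<open>[0,1]\<close>.\<close>

lemma Poincare_subcritical:
  fixes w v :: "real \<Rightarrow> real"
  assumes der: "\<And>t. t \<in> {0..1} \<Longrightarrow> (w has_real_derivative v t) (at t within {0..1})"
    and cv: "continuous_on {0..1} v" and w0: "w 0 = 0" "w 1 = 0" and k: "0 < k" "k < pi"
  shows "k\<^sup>2 * (LINT t|leb01. (w t)\<^sup>2) \<le> (LINT t|leb01. (v t)\<^sup>2)"
proof -
  define c where "c t = - k * tan (k * (t - 1/2))" for t
  \<comment> \<open>Centering at 1/2 exploits the whole interval of length pi on which the cosine is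
    positive; this is why every \<open>k < pi\<close> is admissible.\<close>
  have cosne: "cos (k * (t - 1/2)) > 0" if "t \<in> {0..1}" for t
  proof (rule cos_gt_zero_pi)
    have "k * (t - 1/2) \<le> k * (1/2)" "k * (-1/2) \<le> k * (t - 1/2)"
      using that k by (intro mult_left_mono; simp)+
    then show "- (pi / 2) < k * (t - 1/2)" "k * (t - 1/2) < pi / 2" using k by linarith+
  qed
  have dc: "(c has_real_derivative (- k\<^sup>2 - (c t)\<^sup>2)) (at t within {0..1})" if "t \<in> {0..1}" for t
  proof -
    have ne: "cos (k * (t - 1/2)) \<noteq> 0" using cosne[OF that] by simp
    have "(c has_real_derivative (- k * (inverse ((cos (k * (t - 1/2)))\<^sup>2) * k))) (at t within {0..1})"
      unfolding c_def by (rule derivative_eq_intros refl ne | simp)+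
    moreover have "inverse ((cos (k * (t - 1/2)))\<^sup>2) = 1 + (tan (k * (t - 1/2)))\<^sup>2"
      using tan_sec[OF ne] by (simp add: power_inverse)
    ultimately show ?thesis by (simp add: c_def algebra_simps power2_eq_square)
  qed
  have cw: "continuous_on {0..1} w" by (rule DERIV_continuous_on[OF der])
  have cc: "continuous_on {0..1} c" by (rule DERIV_continuous_on[OF dc])
  \<comment> \<open>This is the derivative of \<open>c w\<^sup>2\<close>; its integral vanishes
    because \<open>w\<close> is 0 at both ends.\<close>
  define \<psi> where "\<psi> t = (- k\<^sup>2 - (c t)\<^sup>2) * (w t)\<^sup>2 + c t * (2 * w t * v t)" for t
  have "((\<lambda>t. c t * (w t)\<^sup>2) has_real_derivative \<psi> t) (at t within {0..1})" if "t \<in> {0..1}" for t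
    unfolding \<psi>_def by (rule derivative_eq_intros dc der that refl | simp add: that)+
  then have "(\<psi> has_integral (c 1 * (w 1)\<^sup>2 - c 0 * (w 0)\<^sup>2)) {0..1}"
    by (intro fundamental_theorem_of_calculus) (auto simp: has_real_derivative_iff_has_vector_derivative)
  then have \<psi>0: "(\<psi> has_integral 0) {0..1}" using w0 by simp
  have c\<psi>: "continuous_on {0..1} \<psi>" unfolding \<psi>_def by (intro continuous_intros cc cw cv)
  have "(LINT t|leb01. \<psi> t) = 0"
    by (rule real_integral_leb01[OF L2_integrable[OF L2_continuous[OF c\<psi>]] \<psi>0])
  moreover have "(LINT t|leb01. (v t - c t * w t)\<^sup>2) \<ge> 0" by simp
  moreover have "(LINT t|leb01. (v t - c t * w t)\<^sup>2) = (LINT t|leb01. (v t)\<^sup>2 - k\<^sup>2 * (w t)\<^sup>2 - \<psi> t)"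
    by (rule Bochner_Integration.integral_cong) (auto simp: \<psi>_def power2_eq_square algebra_simps)
  moreover have "(LINT t|leb01. (v t)\<^sup>2 - k\<^sup>2 * (w t)\<^sup>2 - \<psi> t)
      = (LINT t|leb01. (v t)\<^sup>2) - k\<^sup>2 * (LINT t|leb01. (w t)\<^sup>2) - (LINT t|leb01. \<psi> t)"
    using L2_continuous[OF cv] L2_continuous[OF cw] L2_integrable[OF L2_continuous[OF c\<psi>]]
    by (simp add: L2_def)
  ultimately show ?thesis by simp
qed

text \<open>At \<open>k = pi\<close> the function \<open>c\<close> of the preceding proof blows up
  at both ends, so the sharp constant is reached as a limit from below.\<close>

lemma Poincare:
  fixes w v :: "real \<Rightarrow> real"
  assumes der: "\<And>t. t \<in> {0..1} \<Longrightarrow> (w has_real_derivative v t) (at t within {0..1})"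
    and cv: "continuous_on {0..1} v" and w0: "w 0 = 0" "w 1 = 0"
  shows "pi\<^sup>2 * (LINT t|leb01. (w t)\<^sup>2) \<le> (LINT t|leb01. (v t)\<^sup>2)"
proof (rule tendsto_upperbound)
  show "((\<lambda>k. k\<^sup>2 * (LINT t|leb01. (w t)\<^sup>2)) \<longlongrightarrow> pi\<^sup>2 * (LINT t|leb01. (w t)\<^sup>2)) (at_left pi)"
    by (intro tendsto_intros)
  have "eventually (\<lambda>k. k \<in> {0<..<pi}) (at_left pi)"
    by (rule eventually_at_leftI[of 0]) auto
  then show "eventually (\<lambda>k. k\<^sup>2 * (LINT t|leb01. (w t)\<^sup>2) \<le> (LINT t|leb01. (v t)\<^sup>2)) (at_left pi)"
    by eventually_elim (rule Poincare_subcritical[OF der cv w0], auto)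
qed simp

text \<open>Integration by parts. As \<open>v\<close> is merely absolutely continuous, it is carried
  out through the fundamental theorem for the absolutely continuous product \<open>v w\<close>,
  which vanishes at both ends.\<close>

lemma energy_identity:
  assumes w: "is_ddot w u" "w 0 = 0" "w 1 = 0"
    and v: "abs_cont_on 0 1 w" "abs_cont_on 0 1 v" "ae_deriv v u" "continuous_on {0..1} v"
    "\<And>t. t \<in> {0..1} \<Longrightarrow> (w has_real_derivative v t) (at t within {0..1})"
  shows "(LINT t|leb01. u t * w t) = - (LINT t|leb01. (v t)\<^sup>2)"
proof -
  have ac: "abs_cont_on 0 1 (\<lambda>t. v t * w t)" by (rule abs_cont_on_mult[OF v(2,1)])
  have "AE t in leb01. t \<in> {0<..<1}"
    by (rule AE_leb01_I[of "{0,1}"]) auto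
  then have "ae_deriv (\<lambda>t. v t * w t) (\<lambda>t. u t * w t + v t * v t)"
    using v(3) unfolding ae_deriv_def
  proof eventually_elim
    case (elim t)
    have "(w has_real_derivative v t) (at t)"
      using v(5)[of t] elim(1) at_within_Icc_at[of 0 t 1] by auto
    then show ?case using elim(2) by (auto intro!: derivative_eq_intros)
  qed
  from abs_cont_ae_deriv_integral[OF ac this, of 0 1] w
  have 0: "((\<lambda>t. u t * w t + v t * v t) has_integral 0) {0..1}" by simp
  have L: "L2 u" "L2 w" "L2 v"
    using w(1) L2_continuous v(4) abs_cont_on_imp_continuous_on[OF v(1)] by (auto simp: is_ddot_L2)
  have i: "integrable leb01 (\<lambda>t. u t * w t)" "integrable leb01 (\<lambda>t. v t * v t)"
    by (intro L2_mult_integrable L)+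
  have "(LINT t|leb01. u t * w t + v t * v t) = 0"
    by (rule real_integral_leb01[OF _ 0]) (use i in simp)
  then show ?thesis using i by (simp add: power2_eq_square)
qed

text \<open>Strong monotonicity of \<open>w \<mapsto> r - w''\<close>, turned into a sup-norm estimate; the
  condition \<open>r w \<ge> m w\<^sup>2\<close> replaces \<open>r = a w\<close> with \<open>a \<ge> m\<close>, so that no difference quotient of
  \<open>f\<close> is needed.\<close>

lemma sup_estimate:
  assumes m: "m > - pi\<^sup>2"
  obtains C where "C > 0" "\<And>w u r t. \<lbrakk>is_ddot w u; w 0 = 0; w 1 = 0; L2 r;
      \<And>t. t \<in> {0..1} \<Longrightarrow> r t * w t \<ge> m * (w t)\<^sup>2; t \<in> {0..1}\<rbrakk>
    \<Longrightarrow> \<bar>w t\<bar> \<le> C * L2_norm01 (\<lambda>t. u t - r t)"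
proof -
  \<comment> \<open>Poincare lets \<open>V\<^sup>2\<close> replace \<open>W\<^sup>2\<close> in this
    lower bound only behind a nonpositive factor, so a positive \<open>m\<close> is lowered to 0.
    Then \<open>\<alpha>\<close> is the share of \<open>V\<^sup>2\<close> that survives.\<close>
  define m' where "m' = min m 0"
  define \<alpha> where "\<alpha> = 1 + m' / pi\<^sup>2"
  have "\<alpha> > 0" using m by (auto simp: \<alpha>_def m'_def field_simps min_def)
  show thesis
  \<comment> \<open>The constant combines \<open>\<alpha> V\<^sup>2 \<le> H W\<close> and
    \<open>W \<le> V / pi\<close> into a bound for \<open>V\<close>, which in turn dominates
    \<open>w\<close>.\<close>
  proof (rule that[of "1 / (\<alpha> * pi)"])
    show "1 / (\<alpha> * pi) > 0" using \<open>\<alpha> > 0\<close> by simp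
    fix w u r :: "real \<Rightarrow> real" and t :: real
    assume w: "is_ddot w u" "w 0 = 0" "w 1 = 0" and r: "L2 r"
      and rw: "\<And>t. t \<in> {0..1} \<Longrightarrow> r t * w t \<ge> m * (w t)\<^sup>2" and t: "t \<in> {0..1}"
    obtain v where v: "abs_cont_on 0 1 w" "abs_cont_on 0 1 v" "ae_deriv v u"
      "continuous_on {0..1} w" "continuous_on {0..1} v"
      "\<And>t. t \<in> {0..1} \<Longrightarrow> (w has_real_derivative v t) (at t within {0..1})"
      using w(1) by (elim is_ddotE) blast
    have L: "L2 u" "L2 w" "L2 v" "L2 (\<lambda>t. u t - r t)"
      using w(1) L2_continuous v(4,5) r by (auto simp: is_ddot_L2 L2_diff)
    define W V H where "W = L2_norm01 w" and "V = L2_norm01 v" and "H = L2_norm01 (\<lambda>t. u t - r t)"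
    have pos: "W \<ge> 0" "V \<ge> 0" "H \<ge> 0" by (simp_all add: W_def V_def H_def)
    have P: "pi\<^sup>2 * W\<^sup>2 \<le> V\<^sup>2"
      unfolding W_def V_def L2_norm01_sq by (rule Poincare[OF v(6,5) w(2,3)])
    then have WV: "pi * W \<le> V"
      using pos by (simp add: power_mult_distrib[symmetric] power2_le_iff_abs_le)
    have "(LINT t|leb01. (u t - r t) * w t) = (LINT t|leb01. u t * w t) - (LINT t|leb01. r t * w t)"
      using L2_mult_integrable[OF L(1,2)] L2_mult_integrable[OF r L(2)] by (simp add: left_diff_distrib)
    also have "(LINT t|leb01. u t * w t) = - V\<^sup>2"
      unfolding V_def L2_norm01_sq by (rule energy_identity[OF w v(1,2,3,5,6)])
    finally have e1: "V\<^sup>2 + (LINT t|leb01. r t * w t) = - (LINT t|leb01. (u t - r t) * w t)" by simp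
    have "m' * W\<^sup>2 = (LINT t|leb01. m' * (w t)\<^sup>2)" by (simp add: W_def L2_norm01_sq)
    also have "\<dots> \<le> (LINT t|leb01. r t * w t)"
    proof (rule Bochner_Integration.integral_mono)
      show "integrable leb01 (\<lambda>t. m' * (w t)\<^sup>2)" using L(2) by (simp add: L2_def)
      show "integrable leb01 (\<lambda>t. r t * w t)" by (rule L2_mult_integrable[OF r L(2)])
      fix t assume "t \<in> space leb01"
      then have "m * (w t)\<^sup>2 \<le> r t * w t" using rw by simp
      moreover have "m' * (w t)\<^sup>2 \<le> m * (w t)\<^sup>2" by (rule mult_right_mono) (auto simp: m'_def)
      ultimately show "m' * (w t)\<^sup>2 \<le> r t * w t" by linarith
    qed
    finally have e2: "m' * W\<^sup>2 \<le> (LINT t|leb01. r t * w t)" .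
    have e3: "- (LINT t|leb01. (u t - r t) * w t) \<le> H * W"
      unfolding H_def W_def using L2_Cauchy_Schwarz[OF L(4,2)] by linarith
    have "m' / pi\<^sup>2 * V\<^sup>2 \<le> m' / pi\<^sup>2 * (pi\<^sup>2 * W\<^sup>2)"
      by (rule mult_left_mono_neg[OF P]) (auto simp: m'_def divide_nonpos_pos)
    then have "\<alpha> * V\<^sup>2 \<le> V\<^sup>2 + m' * W\<^sup>2" by (simp add: \<alpha>_def distrib_right)
    also have "\<dots> \<le> H * W" using e1 e2 e3 by linarith
    also have "\<dots> \<le> H * (V / pi)" using WV pos by (intro mult_left_mono) (auto simp: field_simps)
    finally have "V * (\<alpha> * V) \<le> V * (H / pi)" by (simp add: power2_eq_square algebra_simps)
    then have "V > 0 \<Longrightarrow> \<alpha> * V \<le> H / pi" by (rule mult_left_le_imp_le)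
    then have VH: "\<alpha> * V \<le> H / pi" using pos by (cases "V = 0") auto
    \<comment> \<open>Since \<open>w\<close> starts at 0, its value at \<open>t\<close> is the inner
      product of \<open>v\<close> with an indicator of norm at most 1.\<close>
    have "\<bar>w t\<bar> \<le> V"
    proof -
      have i1: "integrable leb01 (\<lambda>s. indicat_real {0<..<t} s * v s)"
        and hi: "(v has_integral (LINT s|leb01. indicat_real {0<..<t} s * v s)) {0..t}"
        using L2_integral_sub[OF L(3), of 0 t] t by auto
      have "(v has_integral (w t - w 0)) {0..t}"
      proof (rule fundamental_theorem_of_calculus)
        fix s assume "s \<in> {0..t}"
        then have "(w has_real_derivative v s) (at s within {0..t})"
          by (intro has_field_derivative_subset[OF v(6)]) (use t in auto)
        then show "(w has_vector_derivative v s) (at s within {0..t})"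
          by (simp add: has_real_derivative_iff_has_vector_derivative)
      qed (use t in auto)
      from has_integral_unique[OF this hi] have "w t = (LINT s|leb01. indicat_real {0<..<t} s * v s)"
        using w(2) by simp
      also have "\<bar>\<dots>\<bar> \<le> L2_norm01 (indicat_real {0<..<t}) * V"
        unfolding V_def
        by (rule L2_Cauchy_Schwarz[OF L2_bounded[OF indicator_measurable01, of _ _ 1] L(3)]) (auto simp: indicator_def)
      also have "\<dots> \<le> 1 * V"
        by (intro mult_right_mono L2_norm01_le_bound indicator_measurable01) (use pos in \<open>auto simp: indicator_def\<close>)
      finally show ?thesis by simp
    qed
    also have "V \<le> 1 / (\<alpha> * pi) * H" using VH \<open>\<alpha> > 0\<close> by (simp add: field_simps)
    finally show "\<bar>w t\<bar> \<le> 1 / (\<alpha> * pi) * L2_norm01 (\<lambda>t. u t - r t)" by (simp add: H_def)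
  qed
qed

section \<open>Solvability\<close>

lemma is_ddot_cong:
  assumes "is_ddot x u" "\<And>t. t \<in> {0..1} \<Longrightarrow> u t = w t"
  shows "is_ddot x w"
proof -
  obtain v where v: "abs_cont_on 0 1 x" "ae_deriv x v" "L2 v" "abs_cont_on 0 1 v" "ae_deriv v u" "L2 u"
    using assms(1) unfolding is_ddot_def by blast
  have "ae_deriv v w"
    using v(5) unfolding ae_deriv_def by (rule AE_mp) (rule AE_I2, simp add: assms(2))
  moreover have "L2 w"
    using v(6) unfolding L2_def
    using measurable_cong[of leb01 u w borel] Bochner_Integration.integrable_cong[of leb01 leb01 "\<lambda>t. (u t)\<^sup>2" "\<lambda>t. (w t)\<^sup>2"]
    by (simp add: assms(2))
  ultimately show ?thesis using v unfolding is_ddot_def by blast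
qed

lemma continuous_on_superposition:
  assumes "continuous_on ({0..1} \<times> UNIV) (\<lambda>(t, x). f t x)" "continuous_on {0..1} x"
  shows "continuous_on {0..1} (\<lambda>t. f t (x t))"
proof -
  have "continuous_on {0..1} (\<lambda>t. (\<lambda>(t, x). f t x) (t, x t))"
    by (rule continuous_on_compose2[OF assms(1)]) (use assms(2) in \<open>auto intro: continuous_intros\<close>)
  then show ?thesis by simp
qed

text \<open>In a continuation step the term \<open>l \<phi>\<close> is treated implicitly, using
  solvability at \<open>l\<close>, and only the small increment \<open>d \<phi>\<close> is evaluated
  at the previous iterate. The contraction factor is therefore \<open>C d M\<close>, where
  \<open>C\<close> does not depend on \<open>l\<close>.\<close>

lemma solvable_globally_Lipschitz:
  assumes cont: "continuous_on ({0..1} \<times> UNIV) (\<lambda>(t, x). \<phi> t x)"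
    and lip: "\<And>t y z. t \<in> {0..1} \<Longrightarrow> \<bar>\<phi> t y - \<phi> t z\<bar> \<le> M * \<bar>y - z\<bar>" and "M > 0"
    and mono: "\<And>t y z. t \<in> {0..1} \<Longrightarrow> (\<phi> t y - \<phi> t z) * (y - z) \<ge> m * (y - z)\<^sup>2"
    and m: "m > - pi\<^sup>2" "m \<le> 0" and "L2 g"
  shows "\<exists>x\<in>Xsp. is_ddot x (\<lambda>t. \<phi> t (x t) + g t)"
proof -
  obtain C where "C > 0" and C: "\<And>w u r t. \<lbrakk>is_ddot w u; w 0 = 0; w 1 = 0; L2 r;
      \<And>t. t \<in> {0..1} \<Longrightarrow> r t * w t \<ge> m * (w t)\<^sup>2; t \<in> {0..1}\<rbrakk>
    \<Longrightarrow> \<bar>w t\<bar> \<le> C * L2_norm01 (\<lambda>t. u t - r t)"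
    using sup_estimate[OF m(1)] by blast
  \<comment> \<open>Solvability is demanded for every right-hand side, so that the lagged term
    \<open>d \<phi>(t, z) + g\<close> can be absorbed into it.\<close>
  define S where "S l \<longleftrightarrow> (\<forall>g. L2 g \<longrightarrow> (\<exists>x\<in>Xsp. is_ddot x (\<lambda>t. l * \<phi> t (x t) + g t)))" for l
  have L2\<phi>: "L2 (\<lambda>t. \<phi> t (x t))" if "continuous_on {0..1} x" for x
    by (rule L2_continuous[OF continuous_on_superposition[OF cont that]])
  have "S 0" unfolding S_def using Xsp_Green by auto
  have step: "S (l + d)" if "S l" "0 \<le> l" "l \<le> 1" "0 \<le> d" "C * (d * M) \<le> 1/2" for l d
    unfolding S_def
  proof (intro allI impI)
    fix g assume g: "L2 g"
    have "\<exists>x\<in>Xsp. is_ddot x (\<lambda>t. l * \<phi> t (x t) + (d * \<phi> t (apply_bcontfun z t) + g t))" for z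
      using \<open>S l\<close> unfolding S_def
      by (elim allE impE) (use L2_lincomb[OF L2\<phi> g, of z d 1] in auto)
    then obtain A where A: "\<And>z. A z \<in> Xsp"
      "\<And>z. is_ddot (A z) (\<lambda>t. l * \<phi> t (A z t) + (d * \<phi> t (apply_bcontfun z t) + g t))"
      by metis
    \<comment> \<open>The complete space at hand consists of bounded continuous functions on the
      whole line, whereas \<open>A z\<close> is controlled on [0,1] only; composing with the
      retraction onto [0,1] makes it an element of that space.\<close>
    define clip :: "real \<Rightarrow> real" where "clip t = max 0 (min 1 t)" for t
    have clip01: "clip t \<in> {0..1}" for t by (auto simp: clip_def)
    have clip_id: "clip t = t" if "t \<in> {0..1}" for t using that by (auto simp: clip_def)
    have "(\<lambda>t. A z (clip t)) \<in> bcontfun" for z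
    proof -
      have cz: "continuous_on {0..1} (A z)" by (rule Xsp_D(3)[OF A(1)])
      obtain K where "\<And>t. t \<in> {0..1} \<Longrightarrow> \<bar>A z t\<bar> \<le> K" using continuous_bounded01[OF cz] by blast
      moreover have "continuous_on UNIV (\<lambda>t. A z (clip t))"
        by (rule continuous_on_compose2[OF cz]) (use clip01 in \<open>auto simp: clip_def[abs_def] intro!: continuous_intros\<close>)
      ultimately show ?thesis by (intro bcontfun_normI[of _ K]) (use clip01 in auto)
    qed
    then have B: "apply_bcontfun (Bcontfun (\<lambda>t. A z (clip t))) t = A z (clip t)" for z t
      by (simp add: Bcontfun_inverse)
    have "dist (Bcontfun (\<lambda>t. A z (clip t))) (Bcontfun (\<lambda>t. A z' (clip t))) \<le> 1/2 * dist z z'" for z z'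
    proof (rule dist_bound)
      fix t
      define w u r where "w = (\<lambda>t. A z t - A z' t)"
        and "u = (\<lambda>t. l * \<phi> t (A z t) + (d * \<phi> t (apply_bcontfun z t) + g t)
            - (l * \<phi> t (A z' t) + (d * \<phi> t (apply_bcontfun z' t) + g t)))"
        and "r = (\<lambda>t. l * \<phi> t (A z t) - l * \<phi> t (A z' t))"
      have wu: "is_ddot w u"
        unfolding w_def u_def using is_ddot_lincomb[OF A(2)[of z] A(2)[of z'], of 1 "-1"]
        by (simp only: mult_1 mult_minus1 add_uminus_conv_diff)
      have w0: "w 0 = 0" "w 1 = 0" by (simp_all add: w_def Xsp_D[OF A(1)])
      have rL: "L2 r"
        unfolding r_def using L2_lincomb[OF L2\<phi> L2\<phi>, OF Xsp_D(3) Xsp_D(3), OF A(1) A(1), of l z "-l" z'] by simp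
      have rw: "r s * w s \<ge> m * (w s)\<^sup>2" if "s \<in> {0..1}" for s
      proof -
        \<comment> \<open>Here \<open>m \<le> 0\<close> enters: scaling by \<open>l\<close> in [0,1]
          can only raise the lower bound, so one constant \<open>C\<close> serves all
          \<open>l\<close>.\<close>
        have "m * (w s)\<^sup>2 \<le> l * (m * (w s)\<^sup>2)"
          using that \<open>l \<le> 1\<close> m(2) \<open>0 \<le> l\<close> mult_right_mono_neg[of l 1 "m * (w s)\<^sup>2"]
          by (simp add: mult_nonpos_nonneg)
        also have "\<dots> \<le> l * ((\<phi> s (A z s) - \<phi> s (A z' s)) * w s)"
          unfolding w_def by (intro mult_left_mono mono that \<open>0 \<le> l\<close>)
        also have "\<dots> = r s * w s" by (simp add: r_def algebra_simps)
        finally show ?thesis .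
      qed
      have "\<bar>w (clip t)\<bar> \<le> C * L2_norm01 (\<lambda>t. u t - r t)"
        by (rule C[OF wu w0 rL rw clip01])
      also have "\<dots> \<le> C * (d * M * dist z z')"
      proof (intro mult_left_mono L2_norm01_le_bound)
        show "(\<lambda>t. u t - r t) \<in> borel_measurable leb01"
          by (rule L2_measurable[OF L2_diff[OF is_ddot_L2[OF wu] rL]])
        fix s :: real assume s: "s \<in> {0..1}"
        \<comment> \<open>The implicit terms and \<open>g\<close> cancel; only the lagged terms,
          with their factor \<open>d\<close>, remain.\<close>
        have "u s - r s = d * (\<phi> s (apply_bcontfun z s) - \<phi> s (apply_bcontfun z' s))"
          by (simp add: u_def r_def algebra_simps)
        then have "\<bar>u s - r s\<bar> = d * \<bar>\<phi> s (apply_bcontfun z s) - \<phi> s (apply_bcontfun z' s)\<bar>"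
          using \<open>0 \<le> d\<close> by (simp add: abs_mult)
        also have "\<dots> \<le> d * (M * \<bar>apply_bcontfun z s - apply_bcontfun z' s\<bar>)"
          by (intro mult_left_mono lip s \<open>0 \<le> d\<close>)
        also have "\<dots> \<le> d * (M * dist z z')"
          using dist_bounded[of z s z'] \<open>0 \<le> d\<close> \<open>M > 0\<close> by (intro mult_left_mono) (auto simp: dist_real_def)
        finally show "\<bar>u s - r s\<bar> \<le> d * M * dist z z'" by (simp add: mult.assoc)
      qed (use \<open>C > 0\<close> \<open>0 \<le> d\<close> \<open>M > 0\<close> in auto)
      also have "\<dots> = C * (d * M) * dist z z'" by simp
      also have "\<dots> \<le> 1/2 * dist z z'" by (intro mult_right_mono that) auto
      finally show "dist (apply_bcontfun (Bcontfun (\<lambda>t. A z (clip t))) t)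
          (apply_bcontfun (Bcontfun (\<lambda>t. A z' (clip t))) t) \<le> 1/2 * dist z z'"
        unfolding B by (simp add: dist_real_def w_def)
    qed
    then have "\<exists>!z. Bcontfun (\<lambda>t. A z (clip t)) = z"
      by (intro banach_fix_type[of "1/2"]) auto
    then obtain z where z: "Bcontfun (\<lambda>t. A z (clip t)) = z" by blast
    have zA: "apply_bcontfun z t = A z t" if "t \<in> {0..1}" for t
      using B[of z t] that by (simp add: z clip_id)
    have "is_ddot (A z) (\<lambda>t. (l + d) * \<phi> t (A z t) + g t)"
      by (rule is_ddot_cong[OF A(2)]) (use zA in \<open>simp add: algebra_simps\<close>)
    then show "\<exists>x\<in>Xsp. is_ddot x (\<lambda>t. (l + d) * \<phi> t (x t) + g t)" using A(1) by blast
  qed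
  \<comment> \<open>Steps of length \<open>1 / n\<close> satisfy
    \<open>C * (M / n) \<le> 1/2\<close>, and \<open>n\<close> of them reach 1.\<close>
  obtain n :: nat where n: "real n > 2 * C * M" using reals_Archimedean2 by blast
  have n0: "real n > 0" using n \<open>C > 0\<close> \<open>M > 0\<close> by (smt (verit) mult_pos_pos)
  have "S (real k / real n)" if "k \<le> n" for k
    using that
  proof (induction k)
    case 0 then show ?case using \<open>S 0\<close> by simp
  next
    case (Suc k)
    then have "S (real k / real n)" "real k / real n \<le> 1" using n0 by (simp_all add: field_simps)
    from step[OF this(1) _ this(2), of "1 / real n"] have "S (real k / real n + 1 / real n)"
      using n n0 by (simp add: field_simps)
    then show ?case using n0 by (simp add: field_simps)
  qed
  from this[of n] have "S 1" using n0 by simp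
  then show ?thesis using \<open>L2 g\<close> by (auto simp: S_def)
qed

text \<open>The second argument is projected onto a band that, by the a priori bound, no solution of
  the truncated problem can leave; such a solution therefore solves the original problem.\<close>

lemma solvable_locally_Lipschitz:
  assumes cont: "continuous_on ({0..1} \<times> UNIV) (\<lambda>(t, x). f t x)"
    and lip: "\<And>R. \<exists>M. \<forall>t\<in>{0..1}. \<forall>y z. \<bar>y\<bar> \<le> R \<longrightarrow> \<bar>z\<bar> \<le> R \<longrightarrow> \<bar>f t y - f t z\<bar> \<le> M * \<bar>y - z\<bar>"
    and mono: "\<And>t y z. t \<in> {0..1} \<Longrightarrow> (f t y - f t z) * (y - z) \<ge> m * (y - z)\<^sup>2"
    and m: "m > - pi\<^sup>2" and g: "L2 g"
  shows "\<exists>x\<in>Xsp. is_ddot x (\<lambda>t. f t (x t) + g t)"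
proof -
  \<comment> \<open>Outside the band the truncated nonlinearity is constant in the second variable,
    so no positive lower slope bound can survive.\<close>
  define m' where "m' = min m 0"
  have m': "m' > - pi\<^sup>2" "m' \<le> 0" using m by (auto simp: m'_def)
  obtain C where "C > 0" and C: "\<And>w u r t. \<lbrakk>is_ddot w u; w 0 = 0; w 1 = 0; L2 r;
      \<And>t. t \<in> {0..1} \<Longrightarrow> r t * w t \<ge> m' * (w t)\<^sup>2; t \<in> {0..1}\<rbrakk>
    \<Longrightarrow> \<bar>w t\<bar> \<le> C * L2_norm01 (\<lambda>t. u t - r t)"
    using sup_estimate[OF m'(1)] by blast
  \<comment> \<open>The radius comes from comparing a solution with 0: subtracting
    \<open>\<phi> t (x t) - \<phi> t 0\<close> from \<open>x''\<close> leaves the residual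
    \<open>f t 0 + g t\<close>. As \<open>M\<close> does not occur in it, \<open>M\<close> can be
    taken for this band afterwards.\<close>
  define R where "R = C * L2_norm01 (\<lambda>t. f t 0 + g t)"
  have "R \<ge> 0" using \<open>C > 0\<close> by (simp add: R_def)
  obtain M where M: "\<And>t y z. t \<in> {0..1} \<Longrightarrow> \<bar>y\<bar> \<le> R \<Longrightarrow> \<bar>z\<bar> \<le> R \<Longrightarrow> \<bar>f t y - f t z\<bar> \<le> M * \<bar>y - z\<bar>"
    using lip[of R] by blast
  define p where "p y = max (- R) (min R y)" for y :: real
  have p: "\<bar>p y\<bar> \<le> R" for y using \<open>R \<ge> 0\<close> by (auto simp: p_def)
  have p_lip: "\<bar>p y - p z\<bar> \<le> \<bar>y - z\<bar>" for y z by (auto simp: p_def)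
  have p_id: "\<bar>y\<bar> \<le> R \<Longrightarrow> p y = y" for y by (auto simp: p_def)
  define \<phi> where "\<phi> t y = f t (p y)" for t y
  have cont\<phi>: "continuous_on ({0..1} \<times> UNIV) (\<lambda>(t, y). \<phi> t y)"
  proof -
    have "continuous_on ({0..1} \<times> UNIV) (\<lambda>q. (\<lambda>(t, x). f t x) (fst q, p (snd q)))"
      by (rule continuous_on_compose2[OF cont]) (auto simp: p_def intro!: continuous_intros)
    then show ?thesis by (simp add: \<phi>_def case_prod_beta)
  qed
  have lip\<phi>: "\<bar>\<phi> t y - \<phi> t z\<bar> \<le> (\<bar>M\<bar> + 1) * \<bar>y - z\<bar>" if "t \<in> {0..1}" for t y z
  proof -
    have "\<bar>\<phi> t y - \<phi> t z\<bar> \<le> M * \<bar>p y - p z\<bar>" unfolding \<phi>_def by (rule M[OF that p p])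
    also have "\<dots> \<le> (\<bar>M\<bar> + 1) * \<bar>y - z\<bar>" by (rule mult_mono) (use p_lip in auto)
    finally show ?thesis .
  qed
  have mono\<phi>: "(\<phi> t y - \<phi> t z) * (y - z) \<ge> m' * (y - z)\<^sup>2" if t: "t \<in> {0..1}" for t y z
  proof (cases "p y = p z")
    case True then show ?thesis using m'(2) by (simp add: \<phi>_def mult_nonpos_nonneg)
  next
    case False
    \<comment> \<open>The projection is monotone and shortens distances, so
      \<open>q \<ge> 1\<close>. Since \<open>m' \<le> 0\<close>, passing from
      \<open>q\<^sup>2 m'\<close> to \<open>q m'\<close> only increases the left-hand side.\<close>
    define q where "q = (y - z) / (p y - p z)"
    have yz: "y - z = q * (p y - p z)" using False by (simp add: q_def)
    have q1: "q \<ge> 1"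
      using False by (auto simp: q_def p_def field_simps divide_simps max_def min_def split: if_splits)
    have "m' * (y - z)\<^sup>2 = q * (q * (m' * (p y - p z)\<^sup>2))" by (simp add: yz power2_eq_square)
    also have "\<dots> \<le> q * (1 * (m' * (p y - p z)\<^sup>2))"
      using q1 m'(2) by (intro mult_left_mono mult_right_mono_neg) (auto simp: mult_nonpos_nonneg)
    also have "\<dots> \<le> q * ((f t (p y) - f t (p z)) * (p y - p z))"
    proof (rule mult_left_mono)
      have "m' * (p y - p z)\<^sup>2 \<le> m * (p y - p z)\<^sup>2" by (rule mult_right_mono) (auto simp: m'_def)
      then show "1 * (m' * (p y - p z)\<^sup>2) \<le> (f t (p y) - f t (p z)) * (p y - p z)"
        using mono[OF t, where y = "p y" and z = "p z"] by simp
    qed (use q1 in simp)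
    also have "\<dots> = (\<phi> t y - \<phi> t z) * (y - z)" by (simp add: \<phi>_def yz)
    finally show ?thesis .
  qed
  have "\<bar>M\<bar> + 1 > 0" by simp
  obtain x where x: "x \<in> Xsp" "is_ddot x (\<lambda>t. \<phi> t (x t) + g t)"
    using solvable_globally_Lipschitz[OF cont\<phi> lip\<phi> \<open>\<bar>M\<bar> + 1 > 0\<close> mono\<phi> m' g] by blast
  have cx: "continuous_on {0..1} x" by (rule Xsp_D(3)[OF x(1)])
  have L: "L2 (\<lambda>t. \<phi> t (x t) - \<phi> t 0)"
    by (intro L2_diff L2_continuous continuous_on_superposition[OF cont\<phi>] cx continuous_on_const)
  have "\<bar>x t\<bar> \<le> R" if t: "t \<in> {0..1}" for t
  proof -
    have "\<bar>x t\<bar> \<le> C * L2_norm01 (\<lambda>t. \<phi> t (x t) + g t - (\<phi> t (x t) - \<phi> t 0))"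
      by (rule C[OF x(2) Xsp_D(1,2)[OF x(1)] L _ t]) (use mono\<phi>[where z = 0] in \<open>simp_all add: Xsp_D(1,2)[OF x(1)]\<close>)
    also have "\<dots> = R" using \<open>R \<ge> 0\<close> by (simp add: R_def \<phi>_def p_id add.commute)
    finally show ?thesis .
  qed
  then have "is_ddot x (\<lambda>t. f t (x t) + g t)"
    by (intro is_ddot_cong[OF x(2)]) (simp add: \<phi>_def p_id)
  then show ?thesis using x(1) by blast
qed

section \<open>A global inverse function theorem for seminormed spaces\<close>

text \<open>Definiteness is deliberately absent: elements are representatives, and distinct ones may
  lie at distance 0.\<close>

definition seminormed :: "(real \<Rightarrow> real) set \<Rightarrow> ((real \<Rightarrow> real) \<Rightarrow> real) \<Rightarrow> bool" where
  "seminormed S N \<longleftrightarrow>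
     (\<forall>x\<in>S. \<forall>y\<in>S. fadd x y \<in> S \<and> N (fadd x y) \<le> N x + N y) \<and>
     (\<forall>c. \<forall>x\<in>S. fscale c x \<in> S \<and> N (fscale c x) = \<bar>c\<bar> * N x) \<and>
     (\<forall>x\<in>S. N x \<ge> 0)"

lemma fun_ops [simp]:
  "fadd x (fsub y x) = y" "fsub (fadd x y) x = y" "fadd x (fscale (-1) y) = fsub x y"
  by (auto simp: fadd_def fsub_def fscale_def)

lemma fun_apply: "fadd x y t = x t + y t" "fsub x y t = x t - y t" "fscale c x t = c * x t"
  by (simp_all add: fadd_def fsub_def fscale_def)

context
  fixes S N assumes SN: "seminormed S N"
begin

lemma seminormed_fadd: "x \<in> S \<Longrightarrow> y \<in> S \<Longrightarrow> fadd x y \<in> S"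
  and seminormed_fscale: "x \<in> S \<Longrightarrow> fscale c x \<in> S"
  and seminormed_nonneg: "x \<in> S \<Longrightarrow> N x \<ge> 0"
  and seminormed_triangle: "x \<in> S \<Longrightarrow> y \<in> S \<Longrightarrow> N (fadd x y) \<le> N x + N y"
  and seminormed_scale: "x \<in> S \<Longrightarrow> N (fscale c x) = \<bar>c\<bar> * N x"
  using SN by (auto simp: seminormed_def)

lemma seminormed_fsub: "x \<in> S \<Longrightarrow> y \<in> S \<Longrightarrow> fsub x y \<in> S"
  using seminormed_fadd[of x "fscale (-1) y"] seminormed_fscale by simp

lemma seminormed_commute:
  assumes "x \<in> S" "y \<in> S" shows "N (fsub x y) = N (fsub y x)"
proof -
  have "fsub x y = fscale (-1) (fsub y x)" by (auto simp: fsub_def fscale_def)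
  then show ?thesis using seminormed_scale[of "fsub y x" "-1"] seminormed_fsub assms by simp
qed

text \<open>The pointwise hypothesis lets a telescoping decomposition of nested differences be
  checked as an identity of real numbers.\<close>

lemma seminormed_sum2:
  assumes "a \<in> S" "b \<in> S" "\<And>t. z t = a t + b t"
  shows "N z \<le> N a + N b"
proof -
  have "z = fadd a b" by (rule ext) (simp add: fun_apply assms(3))
  then show ?thesis using seminormed_triangle assms(1,2) by simp
qed

lemma seminormed_sum3:
  assumes "a \<in> S" "b \<in> S" "c \<in> S" "\<And>t. z t = a t + b t + c t"
  shows "N z \<le> N a + N b + N c"
  using seminormed_sum2[OF seminormed_fadd[OF assms(1,2)] assms(3), of z] seminormed_triangle[OF assms(1,2)]
  by (simp add: assms(4) fun_apply)

end

text \<open>\<open>bounded_lin\<close> grants additivity and homogeneity only up to seminorm 0, so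
  compatibility with differences costs one null term for each of them.\<close>

lemma bounded_lin_fsub:
  assumes L: "bounded_lin S1 N1 S2 N2 L" and S1: "seminormed S1 N1" and S2: "seminormed S2 N2"
    and h: "h \<in> S1" and k: "k \<in> S1"
  shows "N2 (fsub (L (fsub h k)) (fsub (L h) (L k))) = 0"
proof -
  have k': "fscale (-1) k \<in> S1" by (rule seminormed_fscale[OF S1 k])
  have LS: "L x \<in> S2" if "x \<in> S1" for x using L that by (auto simp: bounded_lin_def)
  have 1: "N2 (fsub (L (fsub h k)) (fadd (L h) (L (fscale (-1) k)))) = 0"
    using L h k' unfolding bounded_lin_def by (metis fun_ops(3))
  have 2: "N2 (fsub (L (fscale (-1) k)) (fscale (-1) (L k))) = 0"
    using L k unfolding bounded_lin_def by blast
  note cl = seminormed_fadd[OF S2] seminormed_fsub[OF S2] seminormed_fscale[OF S2] LS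
    seminormed_fsub[OF S1]
  have "N2 (fsub (L (fsub h k)) (fsub (L h) (L k)))
     \<le> N2 (fsub (L (fsub h k)) (fadd (L h) (L (fscale (-1) k)))) + N2 (fsub (L (fscale (-1) k)) (fscale (-1) (L k)))"
    by (rule seminormed_sum2[OF S2]) (use h k k' in \<open>auto intro!: cl simp: fun_apply\<close>)
  moreover have "N2 (fsub (L (fsub h k)) (fsub (L h) (L k))) \<ge> 0"
    by (intro seminormed_nonneg[OF S2] cl h k)
  ultimately show ?thesis using 1 2 by simp
qed

text \<open>Solvability of the equation and of its linearisation is assumed, so an inverse can be
  chosen and only its regularity is at stake: \<open>inv_bd\<close> makes it locally Lipschitz, and
  its derivative is the inverse of the derivative, bounded by \<open>lin_bd\<close>. The threshold 1
  makes \<open>inv_bd\<close> local, with a constant that may depend on \<open>x\<close>.\<close>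

lemma diffeo_from_local_bounds:
  assumes S1: "seminormed S1 N1" and S2: "seminormed S2 N2"
    and F: "\<And>x. x \<in> S1 \<Longrightarrow> F x \<in> S2"
    and fr: "\<And>x. x \<in> S1 \<Longrightarrow> frechet_at S1 N1 S2 N2 F x (DF x)"
    and DFcont: "\<And>x \<epsilon>. x \<in> S1 \<Longrightarrow> \<epsilon> > 0 \<Longrightarrow> \<exists>\<delta>>0. \<forall>y\<in>S1. N1 (fsub y x) < \<delta> \<longrightarrow>
          (\<forall>h\<in>S1. N2 (fsub (DF y h) (DF x h)) \<le> \<epsilon> * N1 h)"
    and lin_bd: "\<And>x. x \<in> S1 \<Longrightarrow> \<exists>K>0. \<forall>h\<in>S1. N1 h \<le> K * N2 (DF x h)"
    and lin_surj: "\<And>x k. x \<in> S1 \<Longrightarrow> k \<in> S2 \<Longrightarrow> \<exists>h\<in>S1. N2 (fsub (DF x h) k) = 0"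
    and surj: "\<And>g. g \<in> S2 \<Longrightarrow> \<exists>x\<in>S1. N2 (fsub (F x) g) = 0"
    and inv_bd: "\<And>x. x \<in> S1 \<Longrightarrow> \<exists>K>0. \<forall>w\<in>S1. N2 (fsub (F (fadd x w)) (F x)) < 1 \<longrightarrow>
          N1 w \<le> K * N2 (fsub (F (fadd x w)) (F x))"
  shows "diffeo S1 N1 S2 N2 F"
proof -
  note cl1 = seminormed_fadd[OF S1] seminormed_fsub[OF S1] seminormed_fscale[OF S1]
  note cl2 = seminormed_fadd[OF S2] seminormed_fsub[OF S2] seminormed_fscale[OF S2]
  note nn1 = seminormed_nonneg[OF S1] and nn2 = seminormed_nonneg[OF S2]
  have BL: "bounded_lin S1 N1 S2 N2 (DF x)" if "x \<in> S1" for x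
    using fr[OF that] by (simp add: frechet_at_def)
  have DFS: "DF x h \<in> S2" if "x \<in> S1" "h \<in> S1" for x h
    using BL[OF that(1)] that(2) by (simp add: bounded_lin_def)
  have inj: "N1 (fsub x y) = 0" if x: "x \<in> S1" and y: "y \<in> S1" and 0: "N2 (fsub (F x) (F y)) = 0" for x y
  proof -
    obtain K where "\<forall>w\<in>S1. N2 (fsub (F (fadd y w)) (F y)) < 1 \<longrightarrow> N1 w \<le> K * N2 (fsub (F (fadd y w)) (F y))"
      using inv_bd[OF y] by blast
    then have "N1 (fsub x y) \<le> 0" using 0 cl1(2)[OF x y] by (metis fun_ops(1) less_numeral_extra(1) mult_zero_right)
    then show ?thesis using nn1[OF cl1(2)[OF x y]] by simp
  qed
  \<comment> \<open>Preimages are unique up to seminorm 0 by \<open>inj\<close>, so any choice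
    serves. The price is that \<open>F (G g)\<close> agrees with \<open>g\<close> only up to
    seminorm 0.\<close>
  define G where "G g = (SOME x. x \<in> S1 \<and> N2 (fsub (F x) g) = 0)" for g
  have G: "G g \<in> S1" "N2 (fsub (F (G g)) g) = 0" "N2 (fsub g (F (G g))) = 0" if "g \<in> S2" for g
  proof -
    have "G g \<in> S1 \<and> N2 (fsub (F (G g)) g) = 0"
      unfolding G_def using someI_ex[of "\<lambda>x. x \<in> S1 \<and> N2 (fsub (F x) g) = 0"] surj[OF that] by blast
    then show "G g \<in> S1" "N2 (fsub (F (G g)) g) = 0" by auto
    then show "N2 (fsub g (F (G g))) = 0" using seminormed_commute[OF S2 F that] by simp
  qed
  define L where "L g k = (SOME h. h \<in> S1 \<and> N2 (fsub (DF (G g) h) k) = 0)" for g k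
  have L: "L g k \<in> S1" "N2 (fsub (DF (G g) (L g k)) k) = 0" "N2 (fsub k (DF (G g) (L g k))) = 0"
    if "g \<in> S2" "k \<in> S2" for g k
  proof -
    have "L g k \<in> S1 \<and> N2 (fsub (DF (G g) (L g k)) k) = 0"
      unfolding L_def using someI_ex[of "\<lambda>h. h \<in> S1 \<and> N2 (fsub (DF (G g) h) k) = 0"]
        lin_surj[OF G(1)[OF that(1)] that(2)] by blast
    then show "L g k \<in> S1" "N2 (fsub (DF (G g) (L g k)) k) = 0" by auto
    then show "N2 (fsub k (DF (G g) (L g k))) = 0"
      using seminormed_commute[OF S2 DFS that(2)] G(1)[OF that(1)] by simp
  qed
  have C1F: "C1_map S1 N1 S2 N2 F"
    unfolding C1_map_def using F fr DFcont by blast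
  have Lbd: "\<exists>K. \<forall>k\<in>S2. N1 (L g k) \<le> K * N2 k" if g: "g \<in> S2" for g
  proof -
    obtain K where "K > 0" and K: "\<And>h. h \<in> S1 \<Longrightarrow> N1 h \<le> K * N2 (DF (G g) h)"
      using lin_bd[OF G(1)[OF g]] by blast
    have "N1 (L g k) \<le> K * N2 k" if k: "k \<in> S2" for k
    proof -
      have "N2 (DF (G g) (L g k)) \<le> N2 (fsub (DF (G g) (L g k)) k) + N2 k"
        by (rule seminormed_sum2[OF S2]) (use k L[OF g k] G[OF g] in \<open>auto intro!: cl2 DFS simp: fun_apply\<close>)
      then have "K * N2 (DF (G g) (L g k)) \<le> K * N2 k" using L[OF g k] \<open>K > 0\<close> by simp
      then show ?thesis using K[OF L(1)[OF g k]] by linarith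
    qed
    then show ?thesis by blast
  qed
  have Llin: "bounded_lin S2 N2 S1 N1 (L g)" if g: "g \<in> S2" for g
    unfolding bounded_lin_def
  proof (intro conjI ballI allI)
    note Gg = G(1)[OF g]
    obtain K where "K > 0" and K: "\<And>h. h \<in> S1 \<Longrightarrow> N1 h \<le> K * N2 (DF (G g) h)"
      using lin_bd[OF Gg] by blast
    \<comment> \<open>By \<open>lin_bd\<close> the derivative separates points up to seminorm 0, so
      linearity of the chosen inverse \<open>L g\<close> can be tested after applying
      \<open>DF (G g)\<close>.\<close>
    have null: "N1 (fsub h h') = 0" if h: "h \<in> S1" "h' \<in> S1" and e: "N2 (fsub (DF (G g) h) (DF (G g) h')) = 0" for h h'
    proof -
      have "N2 (DF (G g) (fsub h h')) \<le> N2 (fsub (DF (G g) (fsub h h')) (fsub (DF (G g) h) (DF (G g) h')))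
          + N2 (fsub (DF (G g) h) (DF (G g) h'))"
        by (rule seminormed_sum2[OF S2]) (use h Gg in \<open>auto intro!: cl1 cl2 DFS simp: fun_apply\<close>)
      then have "N2 (DF (G g) (fsub h h')) \<le> 0"
        using e bounded_lin_fsub[OF BL[OF Gg] S1 S2 h] by simp
      then have "K * N2 (DF (G g) (fsub h h')) \<le> 0" using \<open>K > 0\<close> by (simp add: mult_nonneg_nonpos)
      then have "N1 (fsub h h') \<le> 0" using K[OF cl1(2)[OF h]] by linarith
      then show ?thesis using nn1[OF cl1(2)[OF h]] by simp
    qed
    show "L g h \<in> S1" if "h \<in> S2" for h by (rule L(1)[OF g that])
    show "N1 (fsub (L g (fadd h k)) (fadd (L g h) (L g k))) = 0" if hk: "h \<in> S2" "k \<in> S2" for h k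
    proof (rule null)
      note Lh = L[OF g hk(1)] and Lk = L[OF g hk(2)] and Lhk = L[OF g cl2(1)[OF hk]]
      let ?D = "DF (G g)"
      have e: "N2 (fsub (?D (fadd (L g h) (L g k))) (fadd (?D (L g h)) (?D (L g k)))) = 0"
        using BL[OF Gg] Lh(1) Lk(1) by (simp add: bounded_lin_def)
      have DS: "?D (L g (fadd h k)) \<in> S2" "?D (fadd (L g h) (L g k)) \<in> S2" "?D (L g h) \<in> S2" "?D (L g k) \<in> S2"
        using Gg Lh Lk Lhk by (auto intro!: DFS cl1)
      have e': "N2 (fsub (fadd (?D (L g h)) (?D (L g k))) (?D (fadd (L g h) (L g k)))) = 0"
        using e seminormed_commute[OF S2] DS cl2 by simp
      have "N2 (fsub (?D (L g (fadd h k))) (?D (fadd (L g h) (L g k))))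
         \<le> N2 (fsub (?D (L g (fadd h k))) (fadd h k)) + N2 (fadd (fsub h (?D (L g h))) (fsub k (?D (L g k))))
           + N2 (fsub (fadd (?D (L g h)) (?D (L g k))) (?D (fadd (L g h) (L g k))))"
        by (rule seminormed_sum3[OF S2]) (use DS hk in \<open>auto intro!: cl2 simp: fun_apply\<close>)
      also have "\<dots> \<le> 0"
        using e' Lhk seminormed_triangle[OF S2 cl2(2)[OF hk(1) DS(3)] cl2(2)[OF hk(2) DS(4)]] Lh Lk by simp
      finally show "N2 (fsub (?D (L g (fadd h k))) (?D (fadd (L g h) (L g k)))) = 0"
        using nn2[OF cl2(2)[OF DS(1,2)]] by simp
    qed (use L g hk cl1 cl2 in auto)
    show "N1 (fsub (L g (fscale c h)) (fscale c (L g h))) = 0" if h: "h \<in> S2" for h c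
    proof (rule null)
      note Lh = L[OF g h] and Lc = L[OF g cl2(3)[OF h, of c]]
      let ?D = "DF (G g)"
      have e: "N2 (fsub (?D (fscale c (L g h))) (fscale c (?D (L g h)))) = 0"
        using BL[OF Gg] Lh(1) by (simp add: bounded_lin_def)
      have DS: "?D (L g (fscale c h)) \<in> S2" "?D (fscale c (L g h)) \<in> S2" "?D (L g h) \<in> S2"
        using Gg Lh Lc by (auto intro!: DFS cl1)
      have e': "N2 (fsub (fscale c (?D (L g h))) (?D (fscale c (L g h)))) = 0"
        using e seminormed_commute[OF S2] DS cl2 by simp
      have "N2 (fsub (?D (L g (fscale c h))) (?D (fscale c (L g h))))
         \<le> N2 (fsub (?D (L g (fscale c h))) (fscale c h)) + N2 (fscale c (fsub h (?D (L g h))))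
           + N2 (fsub (fscale c (?D (L g h))) (?D (fscale c (L g h))))"
        by (rule seminormed_sum3[OF S2]) (use DS h in \<open>auto intro!: cl2 simp: fun_apply algebra_simps\<close>)
      also have "\<dots> \<le> 0"
        using e' Lc Lh seminormed_scale[OF S2 cl2(2)[OF h DS(3)]] by simp
      finally show "N2 (fsub (?D (L g (fscale c h))) (?D (fscale c (L g h)))) = 0"
        using nn2[OF cl2(2)[OF DS(1,2)]] by simp
    qed (use L g h cl1 cl2 in auto)
    show "\<exists>K. \<forall>h\<in>S2. N1 (L g h) \<le> K * N2 h" by (rule Lbd[OF g])
  qed
  \<comment> \<open>Replacing \<open>F (G g')\<close> and \<open>F (G g)\<close> by
    \<open>g'\<close> and \<open>g\<close> costs only null terms, so the smallness condition of
    \<open>inv_bd\<close> becomes one on \<open>g'\<close> and \<open>g\<close>.\<close>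
  have G_lip: "\<exists>K>0. \<forall>g'\<in>S2. N2 (fsub g' g) < 1 \<longrightarrow>
      N2 (fsub (F (G g')) (F (G g))) \<le> N2 (fsub g' g) \<and> N1 (fsub (G g') (G g)) \<le> K * N2 (fsub g' g)"
    if g: "g \<in> S2" for g
  proof -
    obtain K where "K > 0" and K: "\<And>w. w \<in> S1 \<Longrightarrow> N2 (fsub (F (fadd (G g) w)) (F (G g))) < 1 \<Longrightarrow>
          N1 w \<le> K * N2 (fsub (F (fadd (G g) w)) (F (G g)))"
      using inv_bd[OF G(1)[OF g]] by blast
    have "N2 (fsub (F (G g')) (F (G g))) \<le> N2 (fsub g' g) \<and> N1 (fsub (G g') (G g)) \<le> K * N2 (fsub g' g)"
      if g': "g' \<in> S2" and small: "N2 (fsub g' g) < 1" for g'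
    proof -
      note GG = G[OF g] and GG' = G[OF g']
      have "N2 (fsub (F (G g')) (F (G g))) \<le> N2 (fsub (F (G g')) g') + N2 (fsub g' g) + N2 (fsub g (F (G g)))"
        by (rule seminormed_sum3[OF S2]) (use F GG(1) GG'(1) g g' in \<open>auto intro!: cl2 simp: fun_apply\<close>)
      then have le: "N2 (fsub (F (G g')) (F (G g))) \<le> N2 (fsub g' g)" using GG GG' by simp
      have "N1 (fsub (G g') (G g)) \<le> K * N2 (fsub (F (G g')) (F (G g)))"
        using K[OF cl1(2)[OF GG'(1) GG(1)]] le small by simp
      also have "\<dots> \<le> K * N2 (fsub g' g)" using le \<open>K > 0\<close> by simp
      finally show ?thesis using le by simp
    qed
    then show ?thesis using \<open>K > 0\<close> by blast
  qed
  have Gfr: "frechet_at S2 N2 S1 N1 G g (L g)" if g: "g \<in> S2" for g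
    unfolding frechet_at_def
  proof (intro conjI allI impI)
    show "bounded_lin S2 N2 S1 N1 (L g)" by (rule Llin[OF g])
    fix \<epsilon> :: real assume "\<epsilon> > 0"
    note Gg = G(1)[OF g]
    let ?D = "DF (G g)"
    obtain K1 where "K1 > 0" and K1: "\<And>h. h \<in> S1 \<Longrightarrow> N1 h \<le> K1 * N2 (?D h)"
      using lin_bd[OF Gg] by blast
    obtain K2 where "K2 > 0" and K2: "\<And>g'. g' \<in> S2 \<Longrightarrow> N2 (fsub g' g) < 1 \<Longrightarrow>
        N1 (fsub (G g') (G g)) \<le> K2 * N2 (fsub g' g)"
      using G_lip[OF g] by blast
    \<comment> \<open>\<open>K2\<close> is spent on passing from the increment of \<open>G\<close>
      to \<open>k\<close>, and \<open>K1\<close> on returning from the image under the derivative to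
      the domain.\<close>
    have "\<epsilon> / (K1 * K2) > 0" using \<open>\<epsilon> > 0\<close> \<open>K1 > 0\<close> \<open>K2 > 0\<close> by simp
    then obtain \<delta> where "\<delta> > 0" and \<delta>: "\<And>h. h \<in> S1 \<Longrightarrow> N1 h < \<delta> \<Longrightarrow>
        N2 (fsub (fsub (F (fadd (G g) h)) (F (G g))) (?D h)) \<le> \<epsilon> / (K1 * K2) * N1 h"
      using fr[OF Gg] unfolding frechet_at_def by blast
    show "\<exists>\<delta>>0. \<forall>k\<in>S2. N2 k < \<delta> \<longrightarrow> N1 (fsub (fsub (G (fadd g k)) (G g)) (L g k)) \<le> \<epsilon> * N2 k"
    proof (intro exI[of _ "min 1 (\<delta> / K2)"] conjI ballI impI)
      show "min 1 (\<delta> / K2) > 0" using \<open>\<delta> > 0\<close> \<open>K2 > 0\<close> by simp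
      fix k assume k: "k \<in> S2" and small: "N2 k < min 1 (\<delta> / K2)"
      define g' where "g' = fadd g k"
      have g': "g' \<in> S2" unfolding g'_def by (rule cl2(1)[OF g k])
      have g'g: "fsub g' g = k" by (simp add: g'_def)
      define w where "w = fsub (G g') (G g)"
      have w: "w \<in> S1" "fadd (G g) w = G g'" using G(1)[OF g'] Gg cl1 by (auto simp: w_def)
      have wk: "N1 w \<le> K2 * N2 k" using K2[OF g'] small by (simp add: g'g w_def)
      have "K2 * N2 k < \<delta>" using small \<open>K2 > 0\<close> by (simp add: field_simps)
      with wk have "N1 w < \<delta>" by linarith
      have "N2 (fsub (fsub (F (G g')) (F (G g))) (?D w)) \<le> \<epsilon> / (K1 * K2) * N1 w"
        using \<delta>[OF w(1) \<open>N1 w < \<delta>\<close>] w(2) by simp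
      also have "\<dots> \<le> \<epsilon> / (K1 * K2) * (K2 * N2 k)"
        using wk \<open>\<epsilon> / (K1 * K2) > 0\<close> by (intro mult_left_mono) auto
      also have "\<dots> = \<epsilon> / K1 * N2 k" using \<open>K2 > 0\<close> by simp
      finally have main: "N2 (fsub (fsub (F (G g')) (F (G g))) (?D w)) \<le> \<epsilon> / K1 * N2 k" .
      note Lk = L[OF g k]
      have DS: "?D w \<in> S2" "?D (L g k) \<in> S2" "?D (fsub w (L g k)) \<in> S2" "F (G g) \<in> S2" "F (G g') \<in> S2"
        using w Lk Gg G(1)[OF g'] by (auto intro!: DFS cl1 F)
      have 1: "N2 (fsub (?D (fsub w (L g k))) (fsub (?D w) (?D (L g k)))) = 0"
        by (rule bounded_lin_fsub[OF BL[OF Gg] S1 S2 w(1) Lk(1)])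
      have 2: "N2 (fsub (fsub (F (G g')) (F (G g))) k) \<le> 0"
      proof -
        have "N2 (fsub (fsub (F (G g')) (F (G g))) k) \<le> N2 (fsub (F (G g')) g') + N2 (fsub g (F (G g)))"
          by (rule seminormed_sum2[OF S2]) (use DS g g' in \<open>auto intro!: cl2 simp: fun_apply g'_def\<close>)
        then show ?thesis using G[OF g'] G[OF g] by simp
      qed
      have 3: "N2 (fsub (?D w) (fsub (F (G g')) (F (G g)))) = N2 (fsub (fsub (F (G g')) (F (G g))) (?D w))"
        by (intro seminormed_commute[OF S2] DS cl2)
      have "N2 (fsub (?D w) (?D (L g k))) \<le>
          N2 (fsub (?D w) (fsub (F (G g')) (F (G g)))) + N2 (fsub (fsub (F (G g')) (F (G g))) k)
          + N2 (fsub k (?D (L g k)))"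
        by (rule seminormed_sum3[OF S2]) (use DS k in \<open>auto intro!: cl2 simp: fun_apply\<close>)
      then have 4: "N2 (fsub (?D w) (?D (L g k))) \<le> \<epsilon> / K1 * N2 k" using 2 3 main Lk by simp
      have "N2 (?D (fsub w (L g k))) \<le> N2 (fsub (?D (fsub w (L g k))) (fsub (?D w) (?D (L g k))))
          + N2 (fsub (?D w) (?D (L g k)))"
        by (rule seminormed_sum2[OF S2]) (use DS in \<open>auto intro!: cl2 simp: fun_apply\<close>)
      then have "K1 * N2 (?D (fsub w (L g k))) \<le> K1 * (\<epsilon> / K1 * N2 k)"
        using 1 4 \<open>K1 > 0\<close> by (intro mult_left_mono) auto
      then have "N1 (fsub w (L g k)) \<le> \<epsilon> * N2 k"
        using K1[OF cl1(2)[OF w(1) Lk(1)]] \<open>K1 > 0\<close> by simp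
      then show "N1 (fsub (fsub (G (fadd g k)) (G g)) (L g k)) \<le> \<epsilon> * N2 k" by (simp add: w_def g'_def)
    qed
  qed
  have Gcont: "\<exists>\<delta>>0. \<forall>g'\<in>S2. N2 (fsub g' g) < \<delta> \<longrightarrow> (\<forall>k\<in>S2. N1 (fsub (L g' k) (L g k)) \<le> \<epsilon> * N2 k)"
    if g: "g \<in> S2" and "\<epsilon> > 0" for g \<epsilon>
  proof -
    note Gg = G(1)[OF g]
    let ?D = "DF (G g)"
    obtain K1 where "K1 > 0" and K1: "\<And>h. h \<in> S1 \<Longrightarrow> N1 h \<le> K1 * N2 (?D h)"
      using lin_bd[OF Gg] by blast
    obtain K2 where "K2 > 0" and K2: "\<And>g'. g' \<in> S2 \<Longrightarrow> N2 (fsub g' g) < 1 \<Longrightarrow>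
        N1 (fsub (G g') (G g)) \<le> K2 * N2 (fsub g' g)"
      using G_lip[OF g] by blast
    \<comment> \<open>With \<open>D = N1 (fsub z' z)\<close> the argument ends in
      \<open>D \<le> K1 \<eta> (D + K1 N2 k)\<close>. The first bound on \<open>\<eta>\<close>
      absorbs \<open>D\<close> into the left side, the second makes the rest at most
      \<open>\<epsilon> N2 k\<close>.\<close>
    define \<eta> where "\<eta> = min (1 / (2 * K1)) (\<epsilon> / (2 * K1 * K1))"
    have \<eta>: "\<eta> > 0" "K1 * \<eta> \<le> 1/2" "2 * (K1 * \<eta>) * K1 \<le> \<epsilon>"
    proof -
      show "\<eta> > 0" using \<open>K1 > 0\<close> \<open>\<epsilon> > 0\<close> by (simp add: \<eta>_def)
      have "K1 * \<eta> \<le> K1 * (1 / (2 * K1))" using \<open>K1 > 0\<close> by (intro mult_left_mono) (auto simp: \<eta>_def)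
      then show "K1 * \<eta> \<le> 1/2" using \<open>K1 > 0\<close> by simp
      have "2 * K1 * K1 * \<eta> \<le> 2 * K1 * K1 * (\<epsilon> / (2 * K1 * K1))"
        using \<open>K1 > 0\<close> by (intro mult_left_mono) (auto simp: \<eta>_def)
      then show "2 * (K1 * \<eta>) * K1 \<le> \<epsilon>" using \<open>K1 > 0\<close> by (simp add: ac_simps)
    qed
    obtain \<delta> where "\<delta> > 0" and \<delta>: "\<And>y h. y \<in> S1 \<Longrightarrow> N1 (fsub y (G g)) < \<delta> \<Longrightarrow> h \<in> S1 \<Longrightarrow>
        N2 (fsub (DF y h) (?D h)) \<le> \<eta> * N1 h"
      using DFcont[OF Gg \<eta>(1)] by blast
    show ?thesis
    proof (intro exI[of _ "min 1 (\<delta> / K2)"] conjI ballI impI)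
      show "min 1 (\<delta> / K2) > 0" using \<open>\<delta> > 0\<close> \<open>K2 > 0\<close> by simp
      fix g' k assume g': "g' \<in> S2" and small: "N2 (fsub g' g) < min 1 (\<delta> / K2)" and k: "k \<in> S2"
      note Gg' = G(1)[OF g'] and Lk = L[OF g k] and Lk' = L[OF g' k]
      let ?D' = "DF (G g')"
      have "K2 * N2 (fsub g' g) < \<delta>" using small \<open>K2 > 0\<close> by (simp add: field_simps)
      then have near: "N1 (fsub (G g') (G g)) < \<delta>" using K2[OF g'] small by simp
      define z z' where "z = L g k" and "z' = L g' k"
      have zS: "z \<in> S1" "z' \<in> S1" using Lk Lk' by (auto simp: z_def z'_def)
      have DS: "?D z \<in> S2" "?D z' \<in> S2" "?D' z' \<in> S2" "?D (fsub z' z) \<in> S2"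
        using zS Gg Gg' by (auto intro!: DFS cl1)
      have "N2 (fsub (?D z') (?D' z')) = N2 (fsub (?D' z') (?D z'))"
        by (intro seminormed_commute[OF S2] DS)
      then have 1: "N2 (fsub (?D z') (?D' z')) \<le> \<eta> * N1 z'" using \<delta>[OF Gg' near zS(2)] by simp
      \<comment> \<open>The resolvent identity as an estimate: up to null terms both
        \<open>?D' z'\<close> and \<open>?D z\<close> equal \<open>k\<close>, so
        \<open>?D (z' - z)\<close> is \<open>(?D - ?D') z'\<close>.\<close>
      have "N2 (fsub (?D z') (?D z)) \<le> N2 (fsub (?D z') (?D' z')) + N2 (fsub (?D' z') k) + N2 (fsub k (?D z))"
        by (rule seminormed_sum3[OF S2]) (use DS k in \<open>auto intro!: cl2 simp: fun_apply\<close>)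
      then have 2: "N2 (fsub (?D z') (?D z)) \<le> \<eta> * N1 z'"
        using 1 Lk Lk' by (simp add: z_def z'_def)
      have "N2 (?D (fsub z' z)) \<le> N2 (fsub (?D (fsub z' z)) (fsub (?D z') (?D z))) + N2 (fsub (?D z') (?D z))"
        by (rule seminormed_sum2[OF S2]) (use DS in \<open>auto intro!: cl2 simp: fun_apply\<close>)
      then have 3: "N2 (?D (fsub z' z)) \<le> \<eta> * N1 z'"
        using 2 bounded_lin_fsub[OF BL[OF Gg] S1 S2 zS(2,1)] by simp
      define D where "D = N1 (fsub z' z)"
      have "D \<le> K1 * N2 (?D (fsub z' z))" unfolding D_def by (rule K1[OF cl1(2)[OF zS(2,1)]])
      also have "\<dots> \<le> K1 * (\<eta> * N1 z')" using 3 \<open>K1 > 0\<close> by simp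
      finally have 4: "D \<le> (K1 * \<eta>) * N1 z'" by simp
      have "N2 (?D z) \<le> N2 (fsub (?D z) k) + N2 k"
        by (rule seminormed_sum2[OF S2]) (use DS k in \<open>auto intro!: cl2 simp: fun_apply\<close>)
      then have "K1 * N2 (?D z) \<le> K1 * N2 k" using Lk \<open>K1 > 0\<close> by (simp add: z_def)
      then have 5: "N1 z \<le> K1 * N2 k" using K1[OF zS(1)] by linarith
      have "N1 z' \<le> N1 (fsub z' z) + N1 z"
        by (rule seminormed_sum2[OF S1]) (use zS in \<open>auto intro!: cl1 simp: fun_apply\<close>)
      then have "(K1 * \<eta>) * N1 z' \<le> (K1 * \<eta>) * (D + K1 * N2 k)"
        using 5 \<open>K1 > 0\<close> \<eta>(1) by (intro mult_left_mono) (auto simp: D_def)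
      moreover have "(K1 * \<eta>) * D \<le> 1/2 * D"
        using \<eta>(2) nn1[OF cl1(2)[OF zS(2,1)]] unfolding D_def by (rule mult_right_mono)
      ultimately have "D \<le> 2 * (K1 * \<eta>) * K1 * N2 k" using 4 by (simp add: algebra_simps)
      also have "\<dots> \<le> \<epsilon> * N2 k" by (rule mult_right_mono[OF \<eta>(3) nn2[OF k]])
      finally show "N1 (fsub (L g' k) (L g k)) \<le> \<epsilon> * N2 k" by (simp add: D_def z_def z'_def)
    qed
  qed
  have C1G: "C1_map S2 N2 S1 N1 G"
    unfolding C1_map_def using G(1) Gfr Gcont by (intro conjI exI[of _ L]) blast+
  show ?thesis
    unfolding diffeo_def
  proof (intro conjI exI[of _ G] ballI impI)
    fix x assume x: "x \<in> S1"
    show "N1 (fsub (G (F x)) x) = 0"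
      by (rule inj[OF G(1)[OF F[OF x]] x G(2)[OF F[OF x]]])
  qed (use C1F C1G inj surj G in auto)
qed

section \<open>The boundary value problem\<close>

lemma seminormed_L2: "seminormed {g. L2 g} L2_norm01"
  unfolding seminormed_def fadd_def fscale_def
  by (auto intro: L2_add L2_cmult L2_norm01_triangle simp: L2_norm01_scale)

lemma fadd_Xsp:
  assumes "x \<in> Xsp" "y \<in> Xsp"
  shows "fadd x y \<in> Xsp" "is_ddot (fadd x y) (\<lambda>t. ddot x t + ddot y t)"
  using Xsp_lincomb[OF assms, of 1 1] is_ddot_lincomb[OF assms[THEN Xsp_is_ddot], of 1 1]
  by (simp_all add: fadd_def)

lemma fscale_Xsp:
  assumes "x \<in> Xsp"
  shows "fscale c x \<in> Xsp" "is_ddot (fscale c x) (\<lambda>t. c * ddot x t)"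
  using Xsp_lincomb[OF assms assms, of c 0] is_ddot_lincomb[OF assms[THEN Xsp_is_ddot] assms[THEN Xsp_is_ddot], of c 0]
  by (simp_all add: fscale_def)

lemma L2_ddot: "x \<in> Xsp \<Longrightarrow> L2 (ddot x)"
  by (rule is_ddot_L2[OF Xsp_is_ddot])

lemma seminormed_Xsp: "seminormed Xsp X_norm"
  unfolding seminormed_def
proof (intro conjI ballI allI)
  fix x y assume x: "x \<in> Xsp" and y: "y \<in> Xsp"
  show "fadd x y \<in> Xsp" by (rule fadd_Xsp(1)[OF x y])
  show "X_norm (fadd x y) \<le> X_norm x + X_norm y"
    unfolding X_norm_eq[OF fadd_Xsp(2)[OF x y]] unfolding X_norm_def
    by (rule L2_norm01_triangle[OF L2_ddot[OF x] L2_ddot[OF y]])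
next
  fix c x assume x: "x \<in> Xsp"
  show "fscale c x \<in> Xsp" by (rule fscale_Xsp(1)[OF x])
  show "X_norm (fscale c x) = \<bar>c\<bar> * X_norm x"
    unfolding X_norm_eq[OF fscale_Xsp(2)[OF x]] L2_norm01_scale unfolding X_norm_def ..
next
  fix x show "X_norm x \<ge> 0" by (simp add: X_norm_def)
qed

lemma ddot_AE: "is_ddot x u \<Longrightarrow> AE t in leb01. ddot x t = u t"
  by (rule is_ddot_unique[OF is_ddot_ddot])

lemma L2_mult_continuous:
  assumes "continuous_on {0..1} a" "continuous_on {0..1} x"
  shows "L2 (\<lambda>t. a t * x t)"
  by (rule L2_continuous[OF continuous_on_mult[OF assms]])

theorem theorem4:
  fixes f fx :: "real \<Rightarrow> real \<Rightarrow> real"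
  assumes Cc_cont: "continuous_on ({0..1} \<times> UNIV) (\<lambda>(t, x). f t x)"
      and Cc_deriv: "\<forall>t\<in>{0..1}. \<forall>x. ((\<lambda>y. f t y) has_real_derivative fx t x) (at x)"
      and Cc_deriv_cont: "continuous_on ({0..1} \<times> UNIV) (\<lambda>(t, x). fx t x)"
      and Cf: "\<exists>A B. A > 0 \<and> B > 0 \<and> A < pi\<^sup>2 \<and>
                 (\<forall>t\<in>{0..1}. \<forall>x. \<bar>f t x\<bar> \<le> A * \<bar>x\<bar> + B)"
      and Cfx: "bdd_below {fx t x | t x. t \<in> {0..1}}"
               "Inf {fx t x | t x. t \<in> {0..1}} > - (pi\<^sup>2)"
  shows "diffeo Xsp X_norm {g. L2 g} L2_norm01 (T_op f)"
proof -
  define m where "m = Inf {fx t x | t x. t \<in> {0..1}}"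
  have m: "m > - pi\<^sup>2" using Cfx(2) by (simp add: m_def)
  have fx_ge: "fx t y \<ge> m" if "t \<in> {0..1}" for t y
    unfolding m_def by (rule cInf_lower[OF _ Cfx(1)]) (use that in blast)
  have mvt: "\<exists>\<xi>. \<xi> \<in> closed_segment z y \<and> f t y - f t z = fx t \<xi> * (y - z)" if t: "t \<in> {0..1}" for t y z
  proof -
    have d: "((\<lambda>y. f t y) has_real_derivative fx t s) (at s)" for s using Cc_deriv t by blast
    consider "y = z" | "z < y" | "y < z" by linarith
    then show ?thesis
    proof cases
      case 1 then show ?thesis by auto
    next
      case 2
      from MVT2[OF 2, of "f t" "fx t"] d obtain s where "z < s" "s < y" "f t y - f t z = (y - z) * fx t s" by blast
      then show ?thesis by (intro exI[of _ s]) (auto simp: closed_segment_eq_real_ivl)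
    next
      case 3
      from MVT2[OF 3, of "f t" "fx t"] d obtain s where "y < s" "s < z" "f t z - f t y = (z - y) * fx t s" by blast
      then show ?thesis by (intro exI[of _ s]) (auto simp: closed_segment_eq_real_ivl algebra_simps)
    qed
  qed
  have mono: "(f t y - f t z) * (y - z) \<ge> m * (y - z)\<^sup>2" if t: "t \<in> {0..1}" for t y z
  proof -
    obtain \<xi> where "f t y - f t z = fx t \<xi> * (y - z)" using mvt[OF t] by blast
    then show ?thesis using mult_right_mono[OF fx_ge[OF t, of \<xi>], of "(y - z)\<^sup>2"]
      by (simp add: power2_eq_square mult.assoc)
  qed
  have fx_cont_cpt: "continuous_on ({0..1} \<times> cball 0 R) (\<lambda>(t, x). fx t x)" for R
    by (rule continuous_on_subset[OF Cc_deriv_cont]) auto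
  have cpt: "compact ({0..1::real} \<times> cball (0::real) R)" for R
    by (intro compact_Times) auto
  have lip: "\<exists>M. \<forall>t\<in>{0..1}. \<forall>y z. \<bar>y\<bar> \<le> R \<longrightarrow> \<bar>z\<bar> \<le> R \<longrightarrow> \<bar>f t y - f t z\<bar> \<le> M * \<bar>y - z\<bar>" for R
  proof -
    obtain M where M: "\<And>t y. t \<in> {0..1} \<Longrightarrow> \<bar>y\<bar> \<le> R \<Longrightarrow> \<bar>fx t y\<bar> \<le> M"
      using compact_imp_bounded[OF compact_continuous_image[OF fx_cont_cpt cpt, of R]]
      by (force simp: bounded_iff)
    have "\<bar>f t y - f t z\<bar> \<le> M * \<bar>y - z\<bar>" if t: "t \<in> {0..1}" and R: "\<bar>y\<bar> \<le> R" "\<bar>z\<bar> \<le> R" for t y z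
    proof -
      obtain \<xi> where \<xi>: "\<xi> \<in> closed_segment z y" "f t y - f t z = fx t \<xi> * (y - z)" using mvt[OF t] by blast
      have "\<bar>\<xi>\<bar> \<le> R" using \<xi>(1) R by (auto simp: closed_segment_eq_real_ivl split: if_splits)
      then show ?thesis unfolding \<xi>(2) abs_mult by (intro mult_right_mono M t) auto
    qed
    then show ?thesis by blast
  qed
  \<comment> \<open>Sup-norm continuity of the superposition with f_x. The margin 1 keeps the
    perturbed values in a compact rectangle, where f_x is uniformly continuous.\<close>
  have unif: "\<exists>\<delta>>0. \<forall>t\<in>{0..1}. \<forall>y. \<bar>y - x t\<bar> < \<delta> \<longrightarrow> \<bar>fx t y - fx t (x t)\<bar> \<le> \<epsilon>"
    if x: "continuous_on {0..1} x" and "\<epsilon> > 0" for x \<epsilon>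
  proof -
    obtain R where R: "\<And>t. t \<in> {0..1} \<Longrightarrow> \<bar>x t\<bar> \<le> R" using continuous_bounded01[OF x] by blast
    obtain \<delta> where "\<delta> > 0" and \<delta>: "\<And>p q. \<lbrakk>p \<in> {0..1} \<times> cball 0 (R + 1); q \<in> {0..1} \<times> cball 0 (R + 1); dist q p < \<delta>\<rbrakk>
        \<Longrightarrow> dist (case q of (t, x) \<Rightarrow> fx t x) (case p of (t, x) \<Rightarrow> fx t x) < \<epsilon>"
      using compact_uniformly_continuous[OF fx_cont_cpt cpt, of "R + 1"] \<open>\<epsilon> > 0\<close>
      unfolding uniformly_continuous_on_def by metis
    have "\<bar>fx t y - fx t (x t)\<bar> \<le> \<epsilon>" if t: "t \<in> {0..1}" and y: "\<bar>y - x t\<bar> < min \<delta> 1" for t y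
    proof -
      have "\<bar>x t\<bar> \<le> R + 1" "\<bar>y\<bar> \<le> R + 1" using R[OF t] y by auto
      then show ?thesis using \<delta>[of "(t, x t)" "(t, y)"] t y by (auto simp: dist_Pair_Pair dist_real_def)
    qed
    then show ?thesis using \<open>\<delta> > 0\<close> by (intro exI[of _ "min \<delta> 1"]) auto
  qed
  have cont_f: "continuous_on {0..1} (\<lambda>t. f t (x t))" if "continuous_on {0..1} x" for x
    by (rule continuous_on_superposition[OF Cc_cont that])
  have cont_fx: "continuous_on {0..1} (\<lambda>t. fx t (x t))" if "x \<in> Xsp" for x
    by (rule continuous_on_superposition[OF Cc_deriv_cont Xsp_D(3)[OF that]])
  obtain C where "C > 0" and C: "\<And>w u r t. \<lbrakk>is_ddot w u; w 0 = 0; w 1 = 0; L2 r;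
      \<And>t. t \<in> {0..1} \<Longrightarrow> r t * w t \<ge> m * (w t)\<^sup>2; t \<in> {0..1}\<rbrakk>
    \<Longrightarrow> \<bar>w t\<bar> \<le> C * L2_norm01 (\<lambda>t. u t - r t)"
    using sup_estimate[OF m] by blast
  \<comment> \<open>The embedding of X into the sup norm is the basic estimate with
    \<open>m = 0\<close> and \<open>r = 0\<close>.\<close>
  obtain C0 where "C0 > 0" and C0: "\<And>h t. h \<in> Xsp \<Longrightarrow> t \<in> {0..1} \<Longrightarrow> \<bar>h t\<bar> \<le> C0 * X_norm h"
  proof -
    have "(0::real) > - pi\<^sup>2" by simp
    from sup_estimate[OF this] obtain C0 where "C0 > 0" and C0: "\<And>w u r t. \<lbrakk>is_ddot w u; w 0 = 0; w 1 = 0; L2 r;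
      \<And>t. t \<in> {0..1} \<Longrightarrow> r t * w t \<ge> 0 * (w t)\<^sup>2; t \<in> {0..1}\<rbrakk>
      \<Longrightarrow> \<bar>w t\<bar> \<le> C0 * L2_norm01 (\<lambda>t. u t - r t)" by blast
    have "\<bar>h t\<bar> \<le> C0 * X_norm h" if "h \<in> Xsp" "t \<in> {0..1}" for h t
      using C0[OF Xsp_is_ddot[OF that(1)] Xsp_D(1,2)[OF that(1)] L2_continuous[of "\<lambda>_. 0"] _ that(2)]
      by (simp add: X_norm_def)
    then show thesis using that \<open>C0 > 0\<close> by blast
  qed
  \<comment> \<open>Upgrades the sup bound to the X-norm: in \<open>w'' = (w'' - r) + r\<close> the
    last term is at most \<open>M\<close> times the sup of \<open>w\<close>, hence controlled by the
    residual. It is used for the linearisation and for differences of values of T.\<close>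
  have X_norm_le: "X_norm w \<le> (1 + M * C) * L2_norm01 (\<lambda>t. ddot w t - r t)"
    if w: "w \<in> Xsp" and r: "continuous_on {0..1} r" and rw: "\<And>t. t \<in> {0..1} \<Longrightarrow> r t * w t \<ge> m * (w t)\<^sup>2"
      and M: "\<And>t. t \<in> {0..1} \<Longrightarrow> \<bar>r t\<bar> \<le> M * \<bar>w t\<bar>" "M \<ge> 0" for w r M
  proof -
    let ?N = "L2_norm01 (\<lambda>t. ddot w t - r t)"
    have L: "L2 (ddot w)" "L2 r" by (rule L2_ddot[OF w], rule L2_continuous[OF r])
    have "X_norm w \<le> ?N + L2_norm01 r"
      using L2_norm01_triangle[OF L2_diff[OF L] L(2)] by (simp add: X_norm_def)
    moreover have "L2_norm01 r \<le> M * (C * ?N)"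
    proof (rule L2_norm01_le_bound[OF continuous_measurable01[OF r]])
      fix t :: real assume t: "t \<in> {0..1}"
      have "\<bar>w t\<bar> \<le> C * ?N"
        by (rule C[OF Xsp_is_ddot[OF w] Xsp_D(1,2)[OF w] L(2) rw t])
      then show "\<bar>r t\<bar> \<le> M * (C * ?N)" using M(1)[OF t] mult_left_mono[OF _ M(2)] order_trans by blast
    qed (use M(2) \<open>C > 0\<close> in simp)
    ultimately show ?thesis by (simp add: algebra_simps)
  qed
  let ?DT = "\<lambda>x h t. ddot h t - fx t (x t) * h t"
  have T_L2: "L2 (T_op f x)" if "x \<in> Xsp" for x
    unfolding T_op_def by (intro L2_diff L2_ddot L2_continuous cont_f Xsp_D(3) that)
  have DT_L2: "L2 (?DT x h)" if "x \<in> Xsp" "h \<in> Xsp" for x h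
    by (intro L2_diff L2_ddot L2_mult_continuous cont_fx Xsp_D(3) that)
  \<comment> \<open>The chosen second derivative of a sum is the sum of the chosen ones only almost
    everywhere, so this is an equality of norms rather than of functions.\<close>
  have T_diff: "L2_norm01 (fsub (T_op f (fadd x w)) (T_op f x)) = L2_norm01 (\<lambda>t. ddot w t - (f t (x t + w t) - f t (x t)))"
    if x: "x \<in> Xsp" and w: "w \<in> Xsp" for x w
  proof (rule L2_norm01_cong_AE)
    show "fsub (T_op f (fadd x w)) (T_op f x) \<in> borel_measurable leb01"
      unfolding fsub_def by (intro L2_measurable L2_diff T_L2 fadd_Xsp x w)
    show "(\<lambda>t. ddot w t - (f t (x t + w t) - f t (x t))) \<in> borel_measurable leb01"
      by (intro L2_measurable L2_diff L2_ddot L2_continuous cont_f continuous_on_add Xsp_D(3) x w)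
    show "AE t in leb01. fsub (T_op f (fadd x w)) (T_op f x) t = ddot w t - (f t (x t + w t) - f t (x t))"
      using ddot_AE[OF fadd_Xsp(2)[OF x w]]
      by eventually_elim (simp add: fsub_def T_op_def, simp add: fadd_def)
  qed
  show ?thesis
  proof (rule diffeo_from_local_bounds[OF seminormed_Xsp seminormed_L2, of _ ?DT])
    fix x assume x: "x \<in> Xsp"
    obtain A where "A > 0" and A: "\<And>t. t \<in> {0..1} \<Longrightarrow> \<bar>fx t (x t)\<bar> \<le> A"
      using continuous_bounded01[OF cont_fx[OF x]] by blast
    have fxh: "\<bar>fx t (x t) * h t\<bar> \<le> A * \<bar>h t\<bar>" if "t \<in> {0..1}" for h t
      unfolding abs_mult by (rule mult_right_mono[OF A[OF that]]) simp
    show "T_op f x \<in> {g. L2 g}" using T_L2[OF x] by simp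
    show "frechet_at Xsp X_norm {g. L2 g} L2_norm01 (T_op f) x (?DT x)"
      unfolding frechet_at_def bounded_lin_def
    proof (intro conjI ballI allI impI)
      show "?DT x h \<in> {g. L2 g}" if "h \<in> Xsp" for h using DT_L2[OF x that] by simp
      show "L2_norm01 (fsub (?DT x (fadd h k)) (fadd (?DT x h) (?DT x k))) = 0" if hk: "h \<in> Xsp" "k \<in> Xsp" for h k
      proof -
        have "L2 (fsub (?DT x (fadd h k)) (fadd (?DT x h) (?DT x k)))"
          unfolding fsub_def by (subst (2) fadd_def) (intro L2_diff[of "?DT x (fadd h k)"] L2_add[of "?DT x h"] DT_L2 x hk fadd_Xsp)
        moreover have "AE t in leb01. fsub (?DT x (fadd h k)) (fadd (?DT x h) (?DT x k)) t = 0"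
          using ddot_AE[OF fadd_Xsp(2)[OF hk]]
          by eventually_elim (simp add: fsub_def, simp add: fadd_def algebra_simps)
        ultimately show ?thesis by (simp only: L2_norm01_eq_0_iff)
      qed
      show "L2_norm01 (fsub (?DT x (fscale c h)) (fscale c (?DT x h))) = 0" if h: "h \<in> Xsp" for h c
      proof -
        have "L2 (fsub (?DT x (fscale c h)) (fscale c (?DT x h)))"
          unfolding fsub_def by (subst (2) fscale_def) (intro L2_diff[of "?DT x (fscale c h)"] L2_cmult[of "?DT x h"] DT_L2 x h fscale_Xsp)
        moreover have "AE t in leb01. fsub (?DT x (fscale c h)) (fscale c (?DT x h)) t = 0"
          using ddot_AE[OF fscale_Xsp(2)[OF h]]
          by eventually_elim (simp add: fsub_def, simp add: fscale_def algebra_simps)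
        ultimately show ?thesis by (simp only: L2_norm01_eq_0_iff)
      qed
      have "L2_norm01 (?DT x h) \<le> (1 + A * C0) * X_norm h" if h: "h \<in> Xsp" for h
      proof -
        have c: "continuous_on {0..1} (\<lambda>t. - (fx t (x t) * h t))"
          by (intro continuous_on_minus continuous_on_mult cont_fx x Xsp_D(3) h)
        have "L2_norm01 (\<lambda>t. - (fx t (x t) * h t)) \<le> A * (C0 * X_norm h)"
        proof (rule L2_norm01_le_bound[OF continuous_measurable01[OF c]])
          show "\<bar>- (fx t (x t) * h t)\<bar> \<le> A * (C0 * X_norm h)" if t: "t \<in> {0..1}" for t
            using order_trans[OF fxh[OF t, of h] mult_left_mono[OF C0[OF h t], of A]] \<open>A > 0\<close> by simp
        qed (use \<open>A > 0\<close> \<open>C0 > 0\<close> in \<open>simp add: X_norm_def\<close>)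
        then show ?thesis
          using L2_norm01_triangle[OF L2_ddot[OF h] L2_continuous[OF c]] by (simp add: X_norm_def algebra_simps)
      qed
      then show "\<exists>K. \<forall>h\<in>Xsp. L2_norm01 (?DT x h) \<le> K * X_norm h" by blast
      fix \<epsilon> :: real assume "\<epsilon> > 0"
      then have "\<epsilon> / C0 > 0" using \<open>C0 > 0\<close> by simp
      then obtain \<delta> where "\<delta> > 0" and \<delta>: "\<And>t y. t \<in> {0..1} \<Longrightarrow> \<bar>y - x t\<bar> < \<delta> \<Longrightarrow> \<bar>fx t y - fx t (x t)\<bar> \<le> \<epsilon> / C0"
        using unif[OF Xsp_D(3)[OF x]] by blast
      show "\<exists>\<delta>>0. \<forall>h\<in>Xsp. X_norm h < \<delta> \<longrightarrow>
          L2_norm01 (fsub (fsub (T_op f (fadd x h)) (T_op f x)) (?DT x h)) \<le> \<epsilon> * X_norm h"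
      proof (intro exI[of _ "\<delta> / C0"] conjI ballI impI)
        show "\<delta> / C0 > 0" using \<open>\<delta> > 0\<close> \<open>C0 > 0\<close> by simp
        fix h assume h: "h \<in> Xsp" and small: "X_norm h < \<delta> / C0"
        \<comment> \<open>The second derivatives cancel in the remainder. By the mean value theorem
          it is \<open>fx t (x t) - fx t \<xi>\<close> times \<open>h t\<close>; the first factor is
          at most \<open>\<epsilon> / C0\<close>, which leaves room for the embedding constant in
          the second.\<close>
        let ?R = "\<lambda>t. fx t (x t) * h t - (f t (x t + h t) - f t (x t))"
        have cR: "continuous_on {0..1} ?R"
          by (intro continuous_on_diff continuous_on_mult cont_f continuous_on_add cont_fx Xsp_D(3) x h)
        have "L2_norm01 (fsub (fsub (T_op f (fadd x h)) (T_op f x)) (?DT x h)) = L2_norm01 ?R"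
        proof (rule L2_norm01_cong_AE)
          show "fsub (fsub (T_op f (fadd x h)) (T_op f x)) (?DT x h) \<in> borel_measurable leb01"
            unfolding fsub_def
            by (intro L2_measurable L2_diff[of "\<lambda>t. T_op f (fadd x h) t - T_op f x t"] L2_diff[of "T_op f (fadd x h)"] T_L2 DT_L2 fadd_Xsp x h)
          show "?R \<in> borel_measurable leb01" by (rule continuous_measurable01[OF cR])
          show "AE t in leb01. fsub (fsub (T_op f (fadd x h)) (T_op f x)) (?DT x h) t = ?R t"
            using ddot_AE[OF fadd_Xsp(2)[OF x h]]
            by eventually_elim (simp add: fsub_def T_op_def, simp add: fadd_def)
        qed
        also have "\<dots> \<le> \<epsilon> / C0 * (C0 * X_norm h)"
        proof (rule L2_norm01_le_bound[OF continuous_measurable01[OF cR]])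
          fix t :: real assume t: "t \<in> {0..1}"
          have "C0 * X_norm h < \<delta>" using small \<open>C0 > 0\<close> by (simp add: field_simps)
          then have ht: "\<bar>h t\<bar> < \<delta>" using C0[OF h t] by linarith
          obtain \<xi> where \<xi>: "\<xi> \<in> closed_segment (x t) (x t + h t)" "f t (x t + h t) - f t (x t) = fx t \<xi> * h t"
            using mvt[OF t, of "x t" "x t + h t"] by auto
          have "\<bar>\<xi> - x t\<bar> < \<delta>" using \<xi>(1) ht by (auto simp: closed_segment_eq_real_ivl split: if_splits)
          then have "\<bar>fx t \<xi> - fx t (x t)\<bar> \<le> \<epsilon> / C0" by (rule \<delta>[OF t])
          have "?R t = - ((fx t \<xi> - fx t (x t)) * h t)" using \<xi>(2) by (simp add: algebra_simps)
          then have "\<bar>?R t\<bar> = \<bar>fx t \<xi> - fx t (x t)\<bar> * \<bar>h t\<bar>" by (simp add: abs_mult)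
          also have "\<dots> \<le> \<epsilon> / C0 * (C0 * X_norm h)"
            using \<open>\<epsilon> / C0 > 0\<close> by (intro mult_mono C0 h t) (use \<open>\<bar>fx t \<xi> - fx t (x t)\<bar> \<le> \<epsilon> / C0\<close> in auto)
          finally show "\<bar>?R t\<bar> \<le> \<epsilon> / C0 * (C0 * X_norm h)" .
        qed (use \<open>\<epsilon> > 0\<close> \<open>C0 > 0\<close> in \<open>simp add: X_norm_def\<close>)
        also have "\<dots> = \<epsilon> * X_norm h" using \<open>C0 > 0\<close> by simp
        finally show "L2_norm01 (fsub (fsub (T_op f (fadd x h)) (T_op f x)) (?DT x h)) \<le> \<epsilon> * X_norm h" .
      qed
    qed
    show "\<exists>\<delta>>0. \<forall>y\<in>Xsp. X_norm (fsub y x) < \<delta> \<longrightarrow>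
          (\<forall>h\<in>Xsp. L2_norm01 (fsub (?DT y h) (?DT x h)) \<le> \<epsilon> * X_norm h)" if eps: "\<epsilon> > 0" for \<epsilon>
    proof -
      have e: "\<epsilon> / C0 > 0" using \<open>C0 > 0\<close> eps by simp
      then obtain \<delta> where "\<delta> > 0" and \<delta>: "\<And>t y. t \<in> {0..1} \<Longrightarrow> \<bar>y - x t\<bar> < \<delta> \<Longrightarrow> \<bar>fx t y - fx t (x t)\<bar> \<le> \<epsilon> / C0"
        using unif[OF Xsp_D(3)[OF x]] by blast
      show ?thesis
      proof (intro exI[of _ "\<delta> / C0"] conjI ballI impI)
        show "\<delta> / C0 > 0" using \<open>\<delta> > 0\<close> \<open>C0 > 0\<close> by simp
        fix y h assume y: "y \<in> Xsp" and small: "X_norm (fsub y x) < \<delta> / C0" and h: "h \<in> Xsp"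
        have yx: "fsub y x \<in> Xsp" by (rule seminormed_fsub[OF seminormed_Xsp y x])
        have "L2_norm01 (fsub (?DT y h) (?DT x h)) \<le> \<epsilon> / C0 * (C0 * X_norm h)"
        proof (rule L2_norm01_le_bound)
          show "fsub (?DT y h) (?DT x h) \<in> borel_measurable leb01"
            unfolding fsub_def by (intro L2_measurable L2_diff[of "?DT y h"] DT_L2 x y h)
          fix t :: real assume t: "t \<in> {0..1}"
          have "C0 * X_norm (fsub y x) < \<delta>" using small \<open>C0 > 0\<close> by (simp add: field_simps)
          then have "\<bar>y t - x t\<bar> < \<delta>" using C0[OF yx t] by (simp add: fsub_def)
          then have 1: "\<bar>fx t (y t) - fx t (x t)\<bar> \<le> \<epsilon> / C0" by (rule \<delta>[OF t])
          \<comment> \<open>The term \<open>h''\<close> drops out: two linearisations differ by a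
            multiplication operator, which is small in the sup norm.\<close>
          have "fsub (?DT y h) (?DT x h) t = - ((fx t (y t) - fx t (x t)) * h t)"
            by (simp add: fsub_def algebra_simps)
          then have "\<bar>fsub (?DT y h) (?DT x h) t\<bar> = \<bar>fx t (y t) - fx t (x t)\<bar> * \<bar>h t\<bar>" by (simp add: abs_mult)
          also have "\<dots> \<le> \<epsilon> / C0 * (C0 * X_norm h)"
            using e by (intro mult_mono C0 h t) (use 1 in auto)
          finally show "\<bar>fsub (?DT y h) (?DT x h) t\<bar> \<le> \<epsilon> / C0 * (C0 * X_norm h)" .
        qed (use eps \<open>C0 > 0\<close> in \<open>simp add: X_norm_def\<close>)
        then show "L2_norm01 (fsub (?DT y h) (?DT x h)) \<le> \<epsilon> * X_norm h" using \<open>C0 > 0\<close> by simp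
      qed
    qed
    show "\<exists>K>0. \<forall>h\<in>Xsp. X_norm h \<le> K * L2_norm01 (?DT x h)"
    proof (intro exI[of _ "1 + A * C"] conjI ballI)
      show "1 + A * C > 0" using \<open>A > 0\<close> \<open>C > 0\<close> by (simp add: add_pos_pos)
      fix h assume h: "h \<in> Xsp"
      show "X_norm h \<le> (1 + A * C) * L2_norm01 (?DT x h)"
      proof (rule X_norm_le[OF h])
        show "\<bar>fx t (x t) * h t\<bar> \<le> A * \<bar>h t\<bar>" if "t \<in> {0..1}" for t by (rule fxh[OF that])
        show "continuous_on {0..1} (\<lambda>t. fx t (x t) * h t)"
          by (intro continuous_on_mult cont_fx x Xsp_D(3) h)
        show "m * (h t)\<^sup>2 \<le> fx t (x t) * h t * h t" if "t \<in> {0..1}" for t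
          using mult_right_mono[OF fx_ge[OF that, of "x t"], of "(h t)\<^sup>2"] by (simp add: power2_eq_square mult.assoc)
      qed (use \<open>A > 0\<close> in auto)
    qed
    show "\<exists>h\<in>Xsp. L2_norm01 (fsub (?DT x h) k) = 0" if "k \<in> {g. L2 g}" for k
    proof -
      have k: "L2 k" using that by simp
      \<comment> \<open>The linearised problem is an instance of the nonlinear one, with slope
        \<open>fx t (x t) \<ge> m\<close> at every \<open>y\<close>.\<close>
      have "\<exists>h\<in>Xsp. is_ddot h (\<lambda>t. fx t (x t) * h t + k t)"
      proof (rule solvable_locally_Lipschitz[OF _ _ _ m k])
        have "continuous_on ({0..1} \<times> UNIV) (\<lambda>p. fx (fst p) (x (fst p)) * snd p)"
          by (intro continuous_on_mult continuous_on_compose2[OF cont_fx[OF x]] continuous_intros) auto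
        then show "continuous_on ({0..1} \<times> UNIV) (\<lambda>(t, y). fx t (x t) * y)"
          by (simp add: case_prod_beta)
        show "\<exists>M. \<forall>t\<in>{0..1}. \<forall>y z. \<bar>y\<bar> \<le> R \<longrightarrow> \<bar>z\<bar> \<le> R \<longrightarrow> \<bar>fx t (x t) * y - fx t (x t) * z\<bar> \<le> M * \<bar>y - z\<bar>" for R
          using A by (intro exI[of _ A]) (auto simp: abs_mult simp flip: right_diff_distrib intro!: mult_right_mono)
        show "m * (y - z)\<^sup>2 \<le> (fx t (x t) * y - fx t (x t) * z) * (y - z)" if "t \<in> {0..1}" for t y z
          using mult_right_mono[OF fx_ge[OF that, of "x t"], of "(y - z)\<^sup>2"]
          by (simp add: power2_eq_square mult.assoc flip: right_diff_distrib)
      qed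
      then obtain h where h: "h \<in> Xsp" "is_ddot h (\<lambda>t. fx t (x t) * h t + k t)" by blast
      have "L2 (fsub (?DT x h) k)" unfolding fsub_def by (intro L2_diff[of "?DT x h"] DT_L2 x h k)
      moreover have "AE t in leb01. fsub (?DT x h) k t = 0"
        using ddot_AE[OF h(2)] by eventually_elim (simp add: fsub_def)
      ultimately show ?thesis using h(1) L2_norm01_eq_0_iff by blast
    qed
    show "\<exists>K>0. \<forall>w\<in>Xsp. L2_norm01 (fsub (T_op f (fadd x w)) (T_op f x)) < 1 \<longrightarrow>
          X_norm w \<le> K * L2_norm01 (fsub (T_op f (fadd x w)) (T_op f x))"
    proof -
      obtain B where B: "\<And>t. t \<in> {0..1} \<Longrightarrow> \<bar>x t\<bar> \<le> B" using continuous_bounded01[OF Xsp_D(3)[OF x]] by blast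
      \<comment> \<open>A residual below 1 forces \<open>w\<close> to stay below \<open>C\<close> in
        absolute value, so \<open>x\<close> and \<open>x + w\<close> both lie in the band of radius
        \<open>B + C\<close>, and the Lipschitz constant depends on \<open>x\<close> alone.\<close>
      obtain M where M: "\<And>t y z. t \<in> {0..1} \<Longrightarrow> \<bar>y\<bar> \<le> B + C \<Longrightarrow> \<bar>z\<bar> \<le> B + C \<Longrightarrow> \<bar>f t y - f t z\<bar> \<le> M * \<bar>y - z\<bar>"
        using lip[of "B + C"] by blast
      show ?thesis
      proof (intro exI[of _ "1 + \<bar>M\<bar> * C"] conjI ballI impI)
        show "1 + \<bar>M\<bar> * C > 0" using \<open>C > 0\<close> by (simp add: add_pos_nonneg)
        fix w assume w: "w \<in> Xsp" and small: "L2_norm01 (fsub (T_op f (fadd x w)) (T_op f x)) < 1"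
        let ?r = "\<lambda>t. f t (x t + w t) - f t (x t)"
        have cr: "continuous_on {0..1} ?r"
          by (intro continuous_on_diff cont_f continuous_on_add Xsp_D(3) x w)
        have rw: "m * (w t)\<^sup>2 \<le> ?r t * w t" if "t \<in> {0..1}" for t
          using mono[OF that, of "x t + w t" "x t"] by simp
        have "X_norm w \<le> (1 + \<bar>M\<bar> * C) * L2_norm01 (\<lambda>t. ddot w t - ?r t)"
        proof (rule X_norm_le[OF w cr rw])
          fix t :: real assume t: "t \<in> {0..1}"
          have "\<bar>w t\<bar> \<le> C * L2_norm01 (\<lambda>t. ddot w t - ?r t)"
            by (rule C[OF Xsp_is_ddot[OF w] Xsp_D(1,2)[OF w] L2_continuous[OF cr] rw t])
          also have "\<dots> \<le> C" using small \<open>C > 0\<close> by (simp add: T_diff[OF x w])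
          finally have "\<bar>w t\<bar> \<le> C" .
          then have "\<bar>?r t\<bar> \<le> M * \<bar>w t\<bar>" using M[OF t, of "x t + w t" "x t"] B[OF t] by simp
          also have "\<dots> \<le> \<bar>M\<bar> * \<bar>w t\<bar>" by (rule mult_right_mono) auto
          finally show "\<bar>?r t\<bar> \<le> \<bar>M\<bar> * \<bar>w t\<bar>" .
        qed auto
        then show "X_norm w \<le> (1 + \<bar>M\<bar> * C) * L2_norm01 (fsub (T_op f (fadd x w)) (T_op f x))"
          by (simp add: T_diff[OF x w])
      qed
    qed
  next
    fix g assume "g \<in> {g. L2 g}"
    then have g: "L2 g" by simp
    obtain x where x: "x \<in> Xsp" "is_ddot x (\<lambda>t. f t (x t) + g t)"
      using solvable_locally_Lipschitz[OF Cc_cont lip mono m g] by blast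
    have "L2 (fsub (T_op f x) g)" unfolding fsub_def by (intro L2_diff[of "T_op f x"] T_L2 x g)
    moreover have "AE t in leb01. fsub (T_op f x) g t = 0"
      using ddot_AE[OF x(2)] by eventually_elim (simp add: fsub_def T_op_def)
    ultimately show "\<exists>x\<in>Xsp. L2_norm01 (fsub (T_op f x) g) = 0" using x(1) L2_norm01_eq_0_iff by blast
  qed
qed

end
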